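(* Let $\phi_1,\phi_2$ be rational inner functions on $\mathbb{D}^2$. If there exist $\alpha_1,\alpha_2\in\mathbb{T}$ and $\tau\in\mathbb{T}$ such that both level sets $\mathcal{C}_{\alpha_1}(\phi_1)$ and $\mathcal{C}_{\alpha_2}(\phi_2)$ contain the same vertical line $\{\zeta\in\mathbb{T}^2:\zeta_1=\tau\}$ (or, analogously, the same horizontal line $\{\zeta\in\mathbb{T}^2:\zeta_2=\tau\}$), then the composition operator $C_\Phi:A^2_\beta(\mathbb{D}^2)\to A^2_\beta(\mathbb{D}^2)$ with symbol $\Phi=(\phi_1,\phi_2)$ is not bounded, for all $\beta\ge-1$.
   Context: $\mathbb{D}^2$ is the unit bidisc in $\mathbb{C}^2$, $\mathbb{T}^2$ the bitorus. For $\beta>-1$, $A^2_\beta(\mathbb{D}^2)$ is the space of holomorphic $f$ on $\mathbb{D}^2$ with $\int_{\mathbb{D}^2}|f|^2(1-|z_1|^2)^\beta(1-|z_2|^2)^\beta dV<\infty$, where $dV=dA\times dA$ and $dA=\frac1\pi dx\,dy$; for $\beta=-1$, $A^2_{-1}(\mathbb{D}^2)=H^2(\mathbb{D}^2)$ is the Hardy space. $C_\Phi f=f\circ\Phi$. Rational inner functions (RIFs) are taken of the form $\phi=\widetilde p/p$ with $p\in\mathbb{C}[z_1,z_2]$ of bidegree $(n,m)$ stable (no zeros in $\mathbb{D}^2$) and $\widetilde p(z_1,z_2)=z_1^nz_2^m\overline{p(1/\overline{z_1},1/\overline{z_2})}$. Such $\phi$ has a non-tangential limit $\phi^*(\zeta)\in\mathbb{T}$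 at every $\zeta\in\mathbb{T}^2$. For $\alpha\in\mathbb{T}$ the level set is $\mathcal{C}_\alpha(\phi)=\mathrm{clos}\{\zeta\in\mathbb{T}^2:\phi^*(\zeta)=\alpha\}$. *)

theory Defs
  imports "HOL-Analysis.Analysis" "HOL-Computational_Algebra.Polynomial"
begin

definition bidisc :: "(complex \<times> complex) set" where
  "bidisc = ball 0 1 \<times> ball 0 1"

definition bitorus :: "(complex \<times> complex) set" where
  "bitorus = sphere 0 1 \<times> sphere 0 1"

text \<open>Elements of \<open>\<complex>[z\<^sub>1, z\<^sub>2]\<close> are represented in \<open>\<complex>[z\<^sub>1][z\<^sub>2]\<close>: the outer
  indeterminate is \<open>z\<^sub>2\<close>, and the coefficients are polynomials in \<open>z\<^sub>1\<close>.\<close>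

definition eval2 :: "complex poly poly \<Rightarrow> complex \<times> complex \<Rightarrow> complex" where
  "eval2 p z = poly (poly p [:snd z:]) (fst z)"

text \<open>A bound, not an equality. Reflecting with respect to a bidegree larger than the exact one
  multiplies the reflection by a monomial, so that \<open>z\<^sub>1\<^sup>k z\<^sub>2\<^sup>l\<close> times a quotient of reflection and
  polynomial (for instance a coordinate function, with \<open>p = 1\<close>) is again of the form used
  in \<open>rational_inner\<close> below.\<close>

definition has_bidegree :: "nat \<Rightarrow> nat \<Rightarrow> complex poly poly \<Rightarrow> bool" where
  "has_bidegree n m p \<longleftrightarrow> degree p \<le> m \<and> (\<forall>k. degree (coeff p k) \<le> n)"

text \<open>The polynomial that agrees with
  \<open>z\<^sub>1\<^sup>n z\<^sub>2\<^sup>m cnj (p (1 / cnj z\<^sub>1, 1 / cnj z\<^sub>2))\<close> off the coordinate axes,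
  see \<open>eval2_reflection\<close>. The formula itself is meaningless on the axes.\<close>

definition reflection :: "nat \<Rightarrow> nat \<Rightarrow> complex poly poly \<Rightarrow> complex poly poly" where
  "reflection n m p =
     (\<Sum>k\<le>m. monom (\<Sum>j\<le>n. monom (cnj (coeff (coeff p k) j)) (n - j)) (m - k))"

lemma eval2_conv_sum:
  assumes "has_bidegree n m p"
  shows "eval2 p (z1, z2) = (\<Sum>k\<le>m. \<Sum>j\<le>n. coeff (coeff p k) j * z1 ^ j * z2 ^ k)"
proof -
  have d: "degree p \<le> m" "\<And>k. degree (coeff p k) \<le> n"
    using assms by (auto simp: has_bidegree_def)
  have 0: "poly q x = (\<Sum>i\<le>l. coeff q i * x ^ i)" if "degree q \<le> l"
    for q :: "'a :: comm_semiring_1 poly" and l x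
    unfolding poly_altdef by (rule sum.mono_neutral_left) (use that in \<open>auto intro: le_degree\<close>)
  note 1 = 0[OF d(1)] and 2 = 0[OF d(2)]
  show ?thesis
    by (simp add: eval2_def 1 poly_sum 2 sum_distrib_left poly_const_pow mult_ac)
qed

lemma eval2_reflection:
  assumes "has_bidegree n m p" and "z1 \<noteq> 0" and "z2 \<noteq> 0"
  shows "eval2 (reflection n m p) (z1, z2) =
           z1 ^ n * z2 ^ m * cnj (eval2 p (1 / cnj z1, 1 / cnj z2))"
proof -
  have "eval2 (reflection n m p) (z1, z2) =
          (\<Sum>k\<le>m. \<Sum>j\<le>n. cnj (coeff (coeff p k) j) * z1 ^ (n - j) * z2 ^ (m - k))"
    by (simp add: eval2_def reflection_def poly_sum poly_monom poly_const_pow sum_distrib_left mult_ac)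
  also have "\<dots> = (\<Sum>k\<le>m. \<Sum>j\<le>n. z1 ^ n * z2 ^ m *
                     (cnj (coeff (coeff p k) j) * (1 / z1) ^ j * (1 / z2) ^ k))"
    using assms(2,3) by (intro sum.cong refl) (simp add: power_diff power_divide)
  also have "\<dots> = z1 ^ n * z2 ^ m * cnj (eval2 p (1 / cnj z1, 1 / cnj z2))"
    by (simp add: eval2_conv_sum[OF assms(1)] sum_distrib_left)
  finally show ?thesis .
qed

definition rational_inner :: "(complex \<times> complex \<Rightarrow> complex) \<Rightarrow> bool" where
  "rational_inner \<phi> \<longleftrightarrow>
     (\<exists>n m p. has_bidegree n m p \<and>
        (\<forall>z\<in>bidisc. eval2 p z \<noteq> 0) \<and>
        (\<forall>z\<in>bidisc. \<phi> z = eval2 (reflection n m p) z / eval2 p z))"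

definition stolz_region :: "real \<Rightarrow> complex \<times> complex \<Rightarrow> (complex \<times> complex) set" where
  "stolz_region M \<zeta> =
     {z \<in> bidisc. cmod (fst z - fst \<zeta>) \<le> M * (1 - cmod (fst z)) \<and>
                  cmod (snd z - snd \<zeta>) \<le> M * (1 - cmod (snd z))}"

definition nontangential_limit ::
    "(complex \<times> complex \<Rightarrow> complex) \<Rightarrow> complex \<times> complex \<Rightarrow> complex \<Rightarrow> bool" where
  "nontangential_limit \<phi> \<zeta> L \<longleftrightarrow>
     (\<forall>M>1. (\<phi> \<longlongrightarrow> L) (at \<zeta> within stolz_region M \<zeta>))"

definition level_set ::
    "(complex \<times> complex \<Rightarrow> complex) \<Rightarrow> complex \<Rightarrow> (complex \<times> complex) set" where
  "level_set \<phi> \<alpha> = closure {\<zeta> \<in> bitorus. nontangential_limit \<phi> \<zeta> \<alpha>}"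

definition holomorphic_bidisc :: "(complex \<times> complex \<Rightarrow> complex) \<Rightarrow> bool" where
  "holomorphic_bidisc f \<longleftrightarrow>
     (\<forall>z\<in>bidisc. \<exists>a b. (f has_derivative (\<lambda>h. a * fst h + b * snd h)) (at z))"

definition dA :: "complex measure" where
  "dA = density lborel (\<lambda>_. ennreal (1 / pi))"

definition dV :: "(complex \<times> complex) measure" where
  "dV = dA \<Otimes>\<^sub>M dA"

definition bergman_sq :: "real \<Rightarrow> (complex \<times> complex \<Rightarrow> complex) \<Rightarrow> ennreal" where
  "bergman_sq \<beta> f =
     (\<integral>\<^sup>+z\<in>bidisc. ennreal ((cmod (f z))\<^sup>2 *
        (1 - (cmod (fst z))\<^sup>2) powr \<beta> * (1 - (cmod (snd z))\<^sup>2) powr \<beta>) \<partial>dV)"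

text \<open>The integral is taken over \<open>bitorus\<close> in angular coordinates, with respect to
  normalized arc length in each variable.\<close>

definition hardy_sq :: "(complex \<times> complex \<Rightarrow> complex) \<Rightarrow> ennreal" where
  "hardy_sq f =
     (SUP r\<in>{0<..<1}. ennreal (1 / (2 * pi)\<^sup>2) *
        (\<integral>\<^sup>+\<theta>\<in>{0..2*pi} \<times> {0..2*pi}.
           ennreal ((cmod (f (of_real r * cis (fst \<theta>), of_real r * cis (snd \<theta>))))\<^sup>2) \<partial>lborel))"

definition A2_sq :: "real \<Rightarrow> (complex \<times> complex \<Rightarrow> complex) \<Rightarrow> ennreal" where
  "A2_sq \<beta> f = (if \<beta> = -1 then hardy_sq f else bergman_sq \<beta> f)"

text \<open>Functions on the bidisc are represented by total functions; only their values on
  \<open>bidisc\<close> matter.\<close>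

definition A2 :: "real \<Rightarrow> (complex \<times> complex \<Rightarrow> complex) set" where
  "A2 \<beta> = {f. holomorphic_bidisc f \<and> A2_sq \<beta> f < \<infinity>}"

definition A2_norm :: "real \<Rightarrow> (complex \<times> complex \<Rightarrow> complex) \<Rightarrow> real" where
  "A2_norm \<beta> f = sqrt (enn2real (A2_sq \<beta> f))"

definition composition_op ::
    "(complex \<times> complex \<Rightarrow> complex \<times> complex) \<Rightarrow>
     (complex \<times> complex \<Rightarrow> complex) \<Rightarrow> complex \<times> complex \<Rightarrow> complex" where
  "composition_op \<Phi> f = f \<circ> \<Phi>"

definition bounded_on_A2 ::
    "real \<Rightarrow> ((complex \<times> complex \<Rightarrow> complex) \<Rightarrow> complex \<times> complex \<Rightarrow> complex) \<Rightarrow> bool" where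
  "bounded_on_A2 \<beta> T \<longleftrightarrow>
     (\<forall>f\<in>A2 \<beta>. T f \<in> A2 \<beta>) \<and> (\<exists>C. \<forall>f\<in>A2 \<beta>. A2_norm \<beta> (T f) \<le> C * A2_norm \<beta> f)"

definition vertical_line :: "complex \<Rightarrow> (complex \<times> complex) set" where
  "vertical_line \<tau> = {\<zeta> \<in> bitorus. fst \<zeta> = \<tau>}"

definition horizontal_line :: "complex \<Rightarrow> (complex \<times> complex) set" where
  "horizontal_line \<tau> = {\<zeta> \<in> bitorus. snd \<zeta> = \<tau>}"

end

theory Submission imports Defs begin

text \<open>The function \<open>f(z) = ((1 - cnj \<alpha>\<^sub>1 z\<^sub>1) (1 - cnj \<alpha>\<^sub>2 z\<^sub>2)) powr (- s / 2)\<close> belongs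
  to \<open>A\<^sup>2\<^sub>\<beta>\<close> as soon as \<open>s < \<beta> + 2\<close>, because \<open>(\<alpha>\<^sub>1, \<alpha>\<^sub>2)\<close> is a singularity in each variable
  separately. After dividing out common factors \<open>z\<^sub>1 - \<tau>\<close> of its numerator and denominator, each
  \<open>\<phi>\<^sub>i\<close> is smooth near almost every point of a vertical line \<open>{\<tau>} \<times> \<T>\<close> in its level set, so that
  \<open>\<phi>\<^sub>i - \<alpha>\<^sub>i = O(z\<^sub>1 - \<tau>)\<close> there for both \<open>i\<close> at once. Hence \<open>f \<circ> \<Phi>\<close> grows like
  \<open>|z\<^sub>1 - \<tau>| powr (- s)\<close> along the line, which is not square integrable when \<open>2 s > \<beta> + 2\<close>. The choice
  \<open>s = 3 / 4 * (\<beta> + 2)\<close> gives a single function of the space whose composition with \<open>\<Phi>\<close> leaves it.\<close>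

section \<open>Rational functions near a line in their level set\<close>

text \<open>Divergence is read off from boxes instead of being computed. A box at distance about
  \<open>d\<close> from the line, of fixed length along it, has weighted mass of order
  \<open>d powr (\<beta> + 2)\<close> (arc length \<open>d\<close> when \<beta> = -1). On it the
  squared modulus of the composed function is at least of order \<open>d powr (- 2 * s)\<close>,
  because both factors of \<open>f\<close> are large at once. This is where the common line enters:
  one factor alone would only give the exponent \<open>s\<close>, which is below the threshold
  \<beta> + 2. The product, of order \<open>d powr (- (\<beta> + 2) / 2)\<close>, is unbounded as
  \<open>d\<close> shrinks. Any number strictly between 1/2 and 1 could replace 3/4. With 3/4 one
  has \<open>s = 3 / 4 * (\<beta> + 1) + 3 / 4\<close>: the first summand is absorbed by the weight,
  the second is integrable in one real variable. This also covers -1 < \<beta> < 0, where the weight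
  itself is unbounded at the boundary. Denominators may vanish on the bitorus, where a limit of the
  quotient says nothing direct about its numerator. The control there comes from the hypothesis that
  \<Phi> maps the bidisc into itself: it bounds the numerator by the denominator, and this
  inequality extends to the closed bidisc.\<close>

lemma eval2_pCons: "eval2 (pCons a p) z = poly a (fst z) + snd z * eval2 p z"
  by (simp add: eval2_def)

lemma eval2_0 [simp]: "eval2 0 z = 0"
  by (simp add: eval2_def)

lemma continuous_on_eval2 [continuous_intros]: "continuous_on S (eval2 p)"
proof (induction p)
  case 0
  then show ?case by simp
next
  case (pCons a p)
  then show ?case
    unfolding eval2_pCons[abs_def] by (intro continuous_intros)
qed

lemma eval2_mult: "eval2 (p * q) z = eval2 p z * eval2 q z"
  by (simp add: eval2_def)

lemma eval2_diff: "eval2 (p - q) z = eval2 p z - eval2 q z"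
  by (simp add: eval2_def)

lemma eval2_add: "eval2 (p + q) z = eval2 p z + eval2 q z"
  by (simp add: eval2_def)

lemma eval2_linear: "eval2 [:[:- \<tau>, 1:]:] z = fst z - \<tau>"
  by (simp add: eval2_def)

lemma eval2_smult_const: "eval2 (smult [:a:] p) z = a * eval2 p z"
  by (simp add: eval2_def)

lemma eval2_fixed_fst: "eval2 p (\<tau>, w) = poly (map_poly (\<lambda>c. poly c \<tau>) p) w"
proof (induction p)
  case 0
  then show ?case by simp
next
  case (pCons a p)
  have "map_poly (\<lambda>c. poly c \<tau>) (pCons a p) = pCons (poly a \<tau>) (map_poly (\<lambda>c. poly c \<tau>) p)"
    by (rule map_poly_pCons) auto
  with pCons show ?case by (simp add: eval2_pCons)
qed

text \<open>For fixed first coordinate \<tau>, \<open>p\<close> becomes a polynomial in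
  \<open>w\<close>. Infinitely many zeros annihilate it, so every coefficient of \<open>p\<close>, a
  polynomial in \<open>z\<^sub>1\<close>, has the root \<tau>; divisibility by a constant of the
  outer ring is checked coefficientwise.\<close>

lemma infinite_zeros_imp_dvd:
  assumes "infinite {w. eval2 p (\<tau>, w) = 0}"
  shows "[:[:- \<tau>, 1:]:] dvd p"
proof -
  have "map_poly (\<lambda>c. poly c \<tau>) p = 0"
    using assms poly_roots_finite unfolding eval2_fixed_fst by blast
  then have "coeff (map_poly (\<lambda>c. poly c \<tau>) p) k = 0" for k by simp
  then have "poly (coeff p k) \<tau> = 0" for k by (simp add: coeff_map_poly)
  then show ?thesis
    unfolding const_poly_dvd_iff poly_eq_0_iff_dvd[symmetric] by simp
qed

text \<open>Horner's scheme with the roles of the rings exchanged: a coefficient in the inner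
  variable is lifted to the outer one, and multiplication by the outer variable becomes
  multiplication by \<open>[:[:0, 1:]:]\<close>.\<close>

lemma eval2_swap_ex: "\<exists>q. \<forall>z. eval2 q z = eval2 p (prod.swap z)"
proof (induction p)
  case 0
  have "eval2 0 z = eval2 0 (prod.swap z)" for z by simp
  then show ?case by blast
next
  case (pCons a p)
  then obtain q where q: "\<And>z. eval2 q z = eval2 p (prod.swap z)" by blast
  have "eval2 (map_poly (\<lambda>c. [:c:]) a) z = poly a (snd z)" for z
  proof (induction a)
    case (pCons b a)
    have "map_poly (\<lambda>c. [:c:]) (pCons b a) = pCons [:b:] (map_poly (\<lambda>c. [:c:]) a)"
      by (rule map_poly_pCons) auto
    with pCons show ?case by (simp add: eval2_pCons)
  qed simp
  moreover have "eval2 [:[:0, 1:]:] z = fst z" for z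
    by (simp add: eval2_def)
  ultimately have "eval2 (map_poly (\<lambda>c. [:c:]) a + [:[:0, 1:]:] * q) z = eval2 (pCons a p) (prod.swap z)" for z
    by (simp only: eval2_add eval2_mult q eval2_pCons fst_swap snd_swap)
  then show ?case by blast
qed

section \<open>Boundary values of quotients on the bitorus\<close>

lemma bidisc_iff: "z \<in> bidisc \<longleftrightarrow> cmod (fst z) < 1 \<and> cmod (snd z) < 1"
  by (auto simp: bidisc_def mem_Times_iff)

lemma bitorus_iff: "z \<in> bitorus \<longleftrightarrow> cmod (fst z) = 1 \<and> cmod (snd z) = 1"
  by (auto simp: bitorus_def mem_Times_iff)

lemma bidisc_swap: "prod.swap z \<in> bidisc \<longleftrightarrow> z \<in> bidisc"
  by (auto simp: bidisc_iff)

lemma closure_bidisc: "closure bidisc = cball 0 1 \<times> cball 0 1"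
  by (simp add: bidisc_def closure_Times)

text \<open>Uniqueness of the non-tangential limit needs a nontrivial filter. Radial approach
  provides it, since on the radius the distance to the boundary point equals the distance to the
  circle. The shift \<open>n + 2\<close> keeps the radial factor strictly between 0 and 1.\<close>

lemma at_within_stolz_region_neq_bot:
  assumes "\<zeta> \<in> bitorus" "M > 1"
  shows "at \<zeta> within stolz_region M \<zeta> \<noteq> bot"
proof -
  define X where "X n = (of_real (1 - 1 / real (n + 2)) * fst \<zeta>, of_real (1 - 1 / real (n + 2)) * snd \<zeta>)" for n
  have \<zeta>: "cmod (fst \<zeta>) = 1" "cmod (snd \<zeta>) = 1" using assms by (auto simp: bitorus_iff)
  have b: "0 < 1 - 1 / real (n + 2)" "1 - 1 / real (n + 2) < 1" for n by auto
  have n1: "cmod (of_real (1 - 1 / real (n + 2)) * w) = 1 - 1 / real (n + 2)" if "cmod w = 1" for n w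
    using b(1)[of n] that by (simp only: norm_mult norm_of_real) simp
  have n2: "cmod (of_real (1 - 1 / real (n + 2)) * w - w) = 1 / real (n + 2)" if "cmod w = 1" for n w
  proof -
    have "of_real (1 - 1 / real (n + 2)) * w - w = of_real (- (1 / real (n + 2))) * w"
      unfolding of_real_diff of_real_minus by (simp only: left_diff_distrib of_real_1) simp
    then show ?thesis using that by (simp only: norm_mult norm_of_real) simp
  qed
  have "1 / real (n + 2) \<le> M * (1 - (1 - 1 / real (n + 2)))" for n
    using assms(2) by (simp add: field_simps)
  then have "X n \<in> stolz_region M \<zeta>" for n
    using b(2)[of n] unfolding X_def stolz_region_def bidisc_iff mem_Collect_eq fst_conv snd_conv
      n1[OF \<zeta>(1)] n1[OF \<zeta>(2)] n2[OF \<zeta>(1)] n2[OF \<zeta>(2)] by blast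
  moreover have "X n \<noteq> \<zeta>" for n
    using n1[OF \<zeta>(1), of n] \<zeta> b(2)[of n] by (auto simp: X_def prod_eq_iff)
  moreover have "X \<longlonglongrightarrow> \<zeta>"
  proof -
    have "(\<lambda>n. 1 - 1 / real (n + 2)) \<longlonglongrightarrow> 1 - 0"
      by (intro tendsto_intros LIMSEQ_ignore_initial_segment[OF lim_const_over_n])
    then have *: "(\<lambda>n. of_real (1 - 1 / real (n + 2)) :: complex) \<longlonglongrightarrow> of_real 1"
      by (intro tendsto_of_real) simp
    have "X \<longlonglongrightarrow> (of_real 1 * fst \<zeta>, of_real 1 * snd \<zeta>)"
      unfolding X_def by (intro tendsto_Pair tendsto_mult tendsto_const *)
    then show ?thesis by simp
  qed
  ultimately have "\<zeta> islimpt stolz_region M \<zeta>"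
    unfolding islimpt_sequential by blast
  then show ?thesis by (simp add: trivial_limit_within)
qed

lemma cmod_le_on_closure_bidisc:
  assumes le: "\<And>z. z \<in> bidisc \<Longrightarrow> cmod (r z) \<le> cmod (q z)"
    and cont: "continuous_on UNIV r" "continuous_on UNIV q"
    and z: "cmod (fst z) \<le> 1" "cmod (snd z) \<le> 1"
  shows "cmod (r z) \<le> cmod (q z)"
proof -
  have "closure bidisc \<subseteq> {z. cmod (r z) \<le> cmod (q z)}"
  proof (rule closure_minimal)
    show "bidisc \<subseteq> {z. cmod (r z) \<le> cmod (q z)}" using le by blast
    show "closed {z. cmod (r z) \<le> cmod (q z)}"
      by (intro closed_Collect_le continuous_on_norm cont)
  qed
  moreover have "z \<in> closure bidisc"
    using z by (simp add: closure_bidisc mem_Times_iff)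
  ultimately show ?thesis by blast
qed

text \<open>Clearing the denominator serves two purposes. Where \<open>q\<close> vanishes, the bound
  by \<open>q\<close>, extended to the closed bidisc, makes \<open>r\<close> vanish too, so the
  equation survives there. And the cleared equation is a closed condition, so it passes to the
  closure in \<open>level_set\<close>.\<close>

lemma level_set_quotient:
  assumes \<phi>: "\<And>z. z \<in> bidisc \<Longrightarrow> \<phi> z = r z / q z"
    and le: "\<And>z. z \<in> bidisc \<Longrightarrow> cmod (r z) \<le> cmod (q z)"
    and cont: "continuous_on UNIV r" "continuous_on UNIV q"
    and \<zeta>: "\<zeta> \<in> level_set \<phi> \<alpha>"
  shows "r \<zeta> = \<alpha> * q \<zeta>"
proof -
  let ?S = "{\<zeta> \<in> bitorus. nontangential_limit \<phi> \<zeta> \<alpha>}"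
  have "?S \<subseteq> {z. r z = \<alpha> * q z}"
  proof (intro subsetI CollectI; elim CollectE conjE)
    fix z assume z: "z \<in> bitorus" and "nontangential_limit \<phi> z \<alpha>"
    then have lim: "(\<phi> \<longlongrightarrow> \<alpha>) (at z within stolz_region 2 z)"
      by (simp add: nontangential_limit_def)
    have tend: "(f \<longlongrightarrow> f z) (at z within stolz_region 2 z)" if "continuous_on UNIV f" for f :: "complex \<times> complex \<Rightarrow> complex"
      using that by (meson UNIV_I continuous_on_def subset_UNIV tendsto_within_subset)
    show "r z = \<alpha> * q z"
    proof (cases "q z = 0")
      case False
      have "((\<lambda>w. r w / q w) \<longlongrightarrow> r z / q z) (at z within stolz_region 2 z)"
        by (rule tendsto_divide[OF tend[OF cont(1)] tend[OF cont(2)] False])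
      moreover have "\<forall>\<^sub>F w in at z within stolz_region 2 z. r w / q w = \<phi> w"
        unfolding eventually_at_filter by (rule always_eventually) (simp add: \<phi> stolz_region_def)
      ultimately have "(\<phi> \<longlongrightarrow> r z / q z) (at z within stolz_region 2 z)"
        by (rule Lim_transform_eventually)
      with lim have "r z / q z = \<alpha>"
        using at_within_stolz_region_neq_bot[OF z, of 2] tendsto_unique by fastforce
      then show ?thesis using False by (simp add: field_simps)
    next
      case True
      have "cmod (r z) \<le> cmod (q z)"
        using z by (intro cmod_le_on_closure_bidisc[OF le cont]) (auto simp: bitorus_iff)
      with True show ?thesis by simp
    qed
  qed
  then have "closure ?S \<subseteq> {z. r z = \<alpha> * q z}"
    by (rule closure_minimal) (intro closed_Collect_eq continuous_on_mult continuous_on_const cont)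
  then show ?thesis using \<zeta> by (auto simp: level_set_def)
qed

text \<open>This shape is preserved by exchanging the variables without any bookkeeping of bidegrees
  and reflections.\<close>

definition poly_quotient :: "(complex \<times> complex \<Rightarrow> complex) \<Rightarrow> bool" where
  "poly_quotient \<phi> \<longleftrightarrow> (\<exists>r q. (\<forall>z\<in>bidisc. eval2 q z \<noteq> 0) \<and> (\<forall>z\<in>bidisc. \<phi> z = eval2 r z / eval2 q z))"

lemma rational_inner_imp_poly_quotient: "rational_inner \<phi> \<Longrightarrow> poly_quotient \<phi>"
  unfolding rational_inner_def poly_quotient_def by blast

lemma poly_quotient_swap:
  assumes "poly_quotient \<phi>"
  shows "poly_quotient (\<phi> \<circ> prod.swap)"
proof -
  obtain r q where rq: "\<forall>z\<in>bidisc. eval2 q z \<noteq> 0" "\<forall>z\<in>bidisc. \<phi> z = eval2 r z / eval2 q z"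
    using assms unfolding poly_quotient_def by blast
  obtain r' q' where "\<And>z. eval2 r' z = eval2 r (prod.swap z)" "\<And>z. eval2 q' z = eval2 q (prod.swap z)"
    using eval2_swap_ex by meson
  with rq show ?thesis
    unfolding poly_quotient_def comp_def
    by (intro exI[of _ r'] exI[of _ q']) (auto simp: bidisc_iff)
qed

lemma infinite_sphere_complex: "infinite (sphere (0 :: complex) 1)"
proof
  assume "finite (sphere (0 :: complex) 1)"
  then have "sphere (0 :: complex) 1 = {} \<or> (\<exists>a. sphere (0 :: complex) 1 = {a})"
    by (subst (asm) connected_finite_iff_sing) (simp_all add: connected_sphere)
  moreover have "1 \<in> sphere (0 :: complex) 1" "- 1 \<in> sphere (0 :: complex) 1" by auto
  moreover have "(1 :: complex) \<noteq> - 1" by simp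
  ultimately show False by (metis empty_iff singletonD)
qed

text \<open>Common factors \<open>z\<^sub>1 - \<tau>\<close> are cancelled one at a time: where the denominator vanishes on the
  whole line, boundedness forces the numerator to vanish as well.\<close>

lemma poly_quotient_reduced:
  assumes "\<And>z. z \<in> bidisc \<Longrightarrow> eval2 q z \<noteq> 0"
    and "\<And>z. z \<in> bidisc \<Longrightarrow> cmod (eval2 r z) \<le> cmod (eval2 q z)"
    and \<tau>: "cmod \<tau> = 1"
  shows "\<exists>r' q'. (\<forall>z\<in>bidisc. eval2 q' z \<noteq> 0) \<and>
           (\<forall>z\<in>bidisc. eval2 r' z / eval2 q' z = eval2 r z / eval2 q z) \<and>
           finite {w. eval2 q' (\<tau>, w) = 0}"
  using assms(1,2)
\<comment> \<open>The leading coefficient in \<open>z\<^sub>2\<close> is a polynomial in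
  \<open>z\<^sub>1\<close>, and cancelling \<open>z\<^sub>1 - \<tau>\<close> divides it by this
  linear factor. Its degree is thus a measure that drops by one at each cancellation.\<close>
proof (induction "degree (lead_coeff q)" arbitrary: r q rule: less_induct)
  case less
  show ?case
  proof (cases "finite {w. eval2 q (\<tau>, w) = 0}")
    case True
    with less.prems show ?thesis by blast
  next
    case False
    let ?d = "[:[:- \<tau>, 1:]:]"
    obtain q' where q': "q = ?d * q'"
      using infinite_zeros_imp_dvd[OF False] by blast
    have all0: "eval2 q (\<tau>, w) = 0" for w
      unfolding q' eval2_mult eval2_linear by simp
    have "eval2 r (\<tau>, w) = 0" if "cmod w \<le> 1" for w
      using cmod_le_on_closure_bidisc[of "eval2 r" "eval2 q" "(\<tau>, w)"] less.prems(2) that \<tau> all0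
      by (simp add: continuous_on_eval2)
    then have "sphere 0 1 \<subseteq> {w. eval2 r (\<tau>, w) = 0}" by auto
    then have "infinite {w. eval2 r (\<tau>, w) = 0}"
      using infinite_sphere_complex finite_subset by blast
    then obtain r' where r': "r = ?d * r'"
      using infinite_zeros_imp_dvd by blast
    have ne: "fst z - \<tau> \<noteq> 0" if "z \<in> bidisc" for z
      using that \<tau> by (auto simp: bidisc_iff)
    have er: "eval2 r z = (fst z - \<tau>) * eval2 r' z" and eq: "eval2 q z = (fst z - \<tau>) * eval2 q' z" for z
      unfolding r' q' eval2_mult eval2_linear by simp_all
    have "(0, 0) \<in> bidisc" by (simp add: bidisc_iff)
    then have "q' \<noteq> 0" using less.prems(1) eq by force
    then have "lead_coeff q = [:- \<tau>, 1:] * lead_coeff q'" "lead_coeff q' \<noteq> 0"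
      unfolding q' lead_coeff_mult by auto
    then have "degree (lead_coeff q') < degree (lead_coeff q)"
      by (simp del: mult_pCons_left add: degree_mult_eq)
    moreover have "\<And>z. z \<in> bidisc \<Longrightarrow> eval2 q' z \<noteq> 0"
      using less.prems(1) eq by fastforce
    moreover have "\<And>z. z \<in> bidisc \<Longrightarrow> cmod (eval2 r' z) \<le> cmod (eval2 q' z)"
      using less.prems(2) ne by (simp add: er eq norm_mult)
    ultimately obtain r'' q'' where "\<forall>z\<in>bidisc. eval2 q'' z \<noteq> 0" "finite {w. eval2 q'' (\<tau>, w) = 0}"
      "\<forall>z\<in>bidisc. eval2 r'' z / eval2 q'' z = eval2 r' z / eval2 q' z"
      using less.hyps by blast
    moreover have "eval2 r z / eval2 q z = eval2 r' z / eval2 q' z" if "z \<in> bidisc" for z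
      using ne[OF that] by (simp add: er eq)
    ultimately show ?thesis by auto
  qed
qed

lemma norm_lt_1_imp_num_le:
  fixes a b :: complex
  assumes "cmod (a / b) < 1" "b \<noteq> 0"
  shows "cmod a \<le> cmod b"
proof -
  have "0 < cmod b" using assms(2) by simp
  then show ?thesis using assms(1) by (simp add: norm_divide divide_less_eq)
qed

text \<open>After reduction to \<open>r / q\<close>, the difference is
  \<open>(r - \<alpha> q) / q\<close>. Its numerator vanishes on the whole circle over \<tau>, so
  the factor \<open>z\<^sub>1 - \<tau>\<close> splits off from it. Reducing beforehand is essential:
  it ensures that the remaining denominator has only finitely many zeros on the line.\<close>

lemma quotient_near_vertical_line:
  assumes quot: "poly_quotient \<phi>" and bd: "\<And>z. z \<in> bidisc \<Longrightarrow> cmod (\<phi> z) < 1"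
    and \<tau>: "cmod \<tau> = 1" and line: "vertical_line \<tau> \<subseteq> level_set \<phi> \<alpha>"
  shows "\<exists>q s. finite {w. eval2 q (\<tau>, w) = 0} \<and>
           (\<forall>z\<in>bidisc. \<phi> z - \<alpha> = (fst z - \<tau>) * (eval2 s z / eval2 q z))"
proof -
  obtain r0 q0 where q0: "\<And>z. z \<in> bidisc \<Longrightarrow> eval2 q0 z \<noteq> 0"
    and r0: "\<And>z. z \<in> bidisc \<Longrightarrow> \<phi> z = eval2 r0 z / eval2 q0 z"
    using quot unfolding poly_quotient_def by blast
  have "cmod (eval2 r0 z) \<le> cmod (eval2 q0 z)" if "z \<in> bidisc" for z
    using norm_lt_1_imp_num_le[of "eval2 r0 z" "eval2 q0 z"] bd[OF that] that r0 q0 by simp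
  from poly_quotient_reduced[OF q0 this \<tau>] obtain r q
    where rq: "\<forall>z\<in>bidisc. eval2 q z \<noteq> 0" "\<forall>z\<in>bidisc. eval2 r z / eval2 q z = eval2 r0 z / eval2 q0 z"
      and fin: "finite {w. eval2 q (\<tau>, w) = 0}"
    by blast
  from rq have q: "\<And>z. z \<in> bidisc \<Longrightarrow> eval2 q z \<noteq> 0"
    and \<phi>: "\<And>z. z \<in> bidisc \<Longrightarrow> \<phi> z = eval2 r z / eval2 q z"
    by (simp_all add: r0)
  have le: "cmod (eval2 r z) \<le> cmod (eval2 q z)" if "z \<in> bidisc" for z
    using norm_lt_1_imp_num_le[of "eval2 r z" "eval2 q z"] bd[OF that] \<phi>[OF that] q[OF that] by simp
  have "eval2 r (\<tau>, w) = \<alpha> * eval2 q (\<tau>, w)" if "cmod w = 1" for w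
  proof (rule level_set_quotient[OF \<phi> le])
    show "(\<tau>, w) \<in> level_set \<phi> \<alpha>"
      using line that \<tau> by (auto simp: vertical_line_def bitorus_iff)
  qed (auto intro: continuous_on_eval2)
  then have "sphere 0 1 \<subseteq> {w. eval2 (r - smult [:\<alpha>:] q) (\<tau>, w) = 0}"
    by (auto simp: eval2_diff eval2_smult_const)
  then have "infinite {w. eval2 (r - smult [:\<alpha>:] q) (\<tau>, w) = 0}"
    using infinite_sphere_complex finite_subset by blast
  then obtain s where s: "r - smult [:\<alpha>:] q = [:[:- \<tau>, 1:]:] * s"
    using infinite_zeros_imp_dvd by blast
  have "eval2 r z - \<alpha> * eval2 q z = (fst z - \<tau>) * eval2 s z" for z
    using arg_cong[OF s, of "\<lambda>p. eval2 p z"] by (simp only: eval2_diff eval2_smult_const eval2_mult eval2_linear)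
  then have "\<forall>z\<in>bidisc. \<phi> z - \<alpha> = (fst z - \<tau>) * (eval2 s z / eval2 q z)"
    using q by (simp add: \<phi> field_simps)
  with fin show ?thesis by blast
qed

text \<open>Each denominator excludes finitely many points of the circle, so one \<open>w\<close>
  avoids both exceptional sets. A common \<open>w\<close> yields one neighbourhood on which both
  coordinates of \<Phi> are controlled.\<close>

lemma near_vertical_line:
  assumes quot: "poly_quotient \<phi>1" "poly_quotient \<phi>2"
    and bd: "\<And>z. z \<in> bidisc \<Longrightarrow> (\<phi>1 z, \<phi>2 z) \<in> bidisc"
    and \<tau>: "cmod \<tau> = 1"
    and line: "vertical_line \<tau> \<subseteq> level_set \<phi>1 \<alpha>1" "vertical_line \<tau> \<subseteq> level_set \<phi>2 \<alpha>2"
  shows "\<exists>w C \<epsilon>. cmod w = 1 \<and> C > 0 \<and> \<epsilon> > 0 \<and>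
           (\<forall>z\<in>bidisc. cmod (fst z - \<tau>) \<le> \<epsilon> \<and> cmod (snd z - w) \<le> \<epsilon> \<longrightarrow>
              cmod (\<phi>1 z - \<alpha>1) \<le> C * cmod (fst z - \<tau>) \<and> cmod (\<phi>2 z - \<alpha>2) \<le> C * cmod (fst z - \<tau>))"
proof -
  have bd': "cmod (\<phi>1 z) < 1" "cmod (\<phi>2 z) < 1" if "z \<in> bidisc" for z
    using bd[OF that] by (auto simp: bidisc_iff)
  obtain q1 s1 where fin1: "finite {w. eval2 q1 (\<tau>, w) = 0}"
    and 1: "\<And>z. z \<in> bidisc \<Longrightarrow> \<phi>1 z - \<alpha>1 = (fst z - \<tau>) * (eval2 s1 z / eval2 q1 z)"
    using quotient_near_vertical_line[OF quot(1) bd'(1) \<tau> line(1)] by blast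
  obtain q2 s2 where fin2: "finite {w. eval2 q2 (\<tau>, w) = 0}"
    and 2: "\<And>z. z \<in> bidisc \<Longrightarrow> \<phi>2 z - \<alpha>2 = (fst z - \<tau>) * (eval2 s2 z / eval2 q2 z)"
    using quotient_near_vertical_line[OF quot(2) bd'(2) \<tau> line(2)] by blast
  have "\<not> sphere 0 1 \<subseteq> {w. eval2 q1 (\<tau>, w) = 0} \<union> {w. eval2 q2 (\<tau>, w) = 0}"
    using fin1 fin2 infinite_sphere_complex by (meson finite_UnI finite_subset)
  then obtain w where "w \<in> sphere 0 1" and w': "eval2 q1 (\<tau>, w) \<noteq> 0" "eval2 q2 (\<tau>, w) \<noteq> 0"
    by blast
  then have w: "cmod w = 1" "eval2 q1 (\<tau>, w) \<noteq> 0" "eval2 q2 (\<tau>, w) \<noteq> 0"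
    by auto
  \<comment> \<open>The sum dominates both cofactors, so a single continuity argument and a single
    constant, \<open>h (\<tau>, w) + 1\<close>, serve for both.\<close>
  define h where "h z = cmod (eval2 s1 z / eval2 q1 z) + cmod (eval2 s2 z / eval2 q2 z)" for z
  have "isCont (eval2 p) z" for p z
    using continuous_on_eval2[of UNIV p] continuous_on_eq_continuous_at by blast
  then have "isCont h (\<tau>, w)"
    unfolding h_def by (intro continuous_intros) (use w in auto)
  then obtain e where e: "e > 0" "\<And>z. dist z (\<tau>, w) < e \<Longrightarrow> dist (h z) (h (\<tau>, w)) < 1"
    unfolding continuous_at_eps_delta by (meson zero_less_one)
  define C where "C = h (\<tau>, w) + 1"
  have "h (\<tau>, w) \<ge> 0" by (simp add: h_def)
  have "cmod (\<phi>1 z - \<alpha>1) \<le> C * cmod (fst z - \<tau>) \<and> cmod (\<phi>2 z - \<alpha>2) \<le> C * cmod (fst z - \<tau>)"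
    if z: "z \<in> bidisc" "cmod (fst z - \<tau>) \<le> e / 3" "cmod (snd z - w) \<le> e / 3" for z
  proof -
    have "dist z (\<tau>, w) \<le> dist (fst z) \<tau> + dist (snd z) w"
      using dist_triangle[of z "(\<tau>, w)" "(\<tau>, snd z)"] by (cases z) (simp add: dist_Pair_Pair)
    then have "dist z (\<tau>, w) < e" using z(2,3) e(1) by (simp add: dist_norm)
    then have "h z \<le> C" using e(2)[of z] by (simp add: C_def dist_real_def)
    then have "cmod (eval2 s1 z / eval2 q1 z) \<le> C" "cmod (eval2 s2 z / eval2 q2 z) \<le> C"
      unfolding h_def using norm_ge_zero[of "eval2 s1 z / eval2 q1 z"] norm_ge_zero[of "eval2 s2 z / eval2 q2 z"] by linarith+
    then show ?thesis
      unfolding 1[OF z(1)] 2[OF z(1)] norm_mult by (metis mult.commute mult_left_mono norm_ge_zero)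
  qed
  moreover have "C > 0" "e / 3 > 0"
    using \<open>h (\<tau>, w) \<ge> 0\<close> e(1) by (auto simp: C_def)
  ultimately show ?thesis using w(1) by blast
qed

section \<open>Exchange of the two variables\<close>

lemma nontangential_limit_swap:
  assumes "nontangential_limit \<phi> \<zeta> L"
  shows "nontangential_limit (\<phi> \<circ> prod.swap) (prod.swap \<zeta>) L"
  unfolding nontangential_limit_def comp_def
proof (intro allI impI)
  fix M :: real assume "M > 1"
  then have "(\<phi> \<longlongrightarrow> L) (at \<zeta> within stolz_region M \<zeta>)"
    using assms by (simp add: nontangential_limit_def)
  \<comment> \<open>Stolz regions have the same aperture \<open>M\<close> in both coordinates, so
    the exchange carries one onto the other.\<close>
  moreover have "filterlim prod.swap (at \<zeta> within stolz_region M \<zeta>) (at (prod.swap \<zeta>) within stolz_region M (prod.swap \<zeta>))"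
    unfolding filterlim_at eventually_at_filter
  proof
    have "(prod.swap \<longlongrightarrow> prod.swap (prod.swap \<zeta>)) (at (prod.swap \<zeta>) within stolz_region M (prod.swap \<zeta>))"
      unfolding prod.swap_def by (intro tendsto_intros)
    then show "(prod.swap \<longlongrightarrow> \<zeta>) (at (prod.swap \<zeta>) within stolz_region M (prod.swap \<zeta>))" by simp
  qed (auto intro!: always_eventually simp: stolz_region_def bidisc_iff)
  ultimately show "((\<lambda>x. \<phi> (prod.swap x)) \<longlongrightarrow> L) (at (prod.swap \<zeta>) within stolz_region M (prod.swap \<zeta>))"
    by (rule filterlim_compose)
qed

lemma level_set_swap: "prod.swap ` level_set \<phi> \<alpha> \<subseteq> level_set (\<phi> \<circ> prod.swap) \<alpha>"
  unfolding level_set_def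
proof (rule image_closure_subset)
  show "continuous_on (closure {\<zeta> \<in> bitorus. nontangential_limit \<phi> \<zeta> \<alpha>}) prod.swap"
    unfolding prod.swap_def by (intro continuous_intros)
  show "prod.swap ` {\<zeta> \<in> bitorus. nontangential_limit \<phi> \<zeta> \<alpha>}
          \<subseteq> closure {\<zeta> \<in> bitorus. nontangential_limit (\<phi> \<circ> prod.swap) \<zeta> \<alpha>}"
  proof (intro subset_trans[OF _ closure_subset] image_subsetI)
    fix \<zeta> assume "\<zeta> \<in> {\<zeta> \<in> bitorus. nontangential_limit \<phi> \<zeta> \<alpha>}"
    then show "prod.swap \<zeta> \<in> {\<zeta> \<in> bitorus. nontangential_limit (\<phi> \<circ> prod.swap) \<zeta> \<alpha>}"
      using nontangential_limit_swap[of \<phi> \<zeta> \<alpha>] by (simp add: bitorus_iff)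
  qed
qed simp

lemma vertical_line_subset_level_set_swap:
  assumes "horizontal_line \<tau> \<subseteq> level_set \<phi> \<alpha>"
  shows "vertical_line \<tau> \<subseteq> level_set (\<phi> \<circ> prod.swap) \<alpha>"
proof -
  have "vertical_line \<tau> = prod.swap ` horizontal_line \<tau>"
    by (force simp: vertical_line_def horizontal_line_def bitorus_iff)
  then show ?thesis using assms level_set_swap by blast
qed

text \<open>Only the arguments of \<phi>1 and \<phi>2 are exchanged, not the two functions, so each
  \<alpha> stays with its own function.\<close>

lemma near_horizontal_line:
  assumes quot: "poly_quotient \<phi>1" "poly_quotient \<phi>2"
    and bd: "\<And>z. z \<in> bidisc \<Longrightarrow> (\<phi>1 z, \<phi>2 z) \<in> bidisc"
    and \<tau>: "cmod \<tau> = 1"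
    and line: "horizontal_line \<tau> \<subseteq> level_set \<phi>1 \<alpha>1" "horizontal_line \<tau> \<subseteq> level_set \<phi>2 \<alpha>2"
  shows "\<exists>w C \<epsilon>. cmod w = 1 \<and> C > 0 \<and> \<epsilon> > 0 \<and>
           (\<forall>z\<in>bidisc. cmod (fst z - w) \<le> \<epsilon> \<and> cmod (snd z - \<tau>) \<le> \<epsilon> \<longrightarrow>
              cmod (\<phi>1 z - \<alpha>1) \<le> C * cmod (snd z - \<tau>) \<and> cmod (\<phi>2 z - \<alpha>2) \<le> C * cmod (snd z - \<tau>))"
proof -
  have "((\<phi>1 \<circ> prod.swap) z, (\<phi>2 \<circ> prod.swap) z) \<in> bidisc" if "z \<in> bidisc" for z
    using bd[of "prod.swap z"] that by (simp add: bidisc_swap)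
  from near_vertical_line[OF poly_quotient_swap[OF quot(1)] poly_quotient_swap[OF quot(2)] this \<tau>
      vertical_line_subset_level_set_swap[OF line(1)] vertical_line_subset_level_set_swap[OF line(2)]]
  obtain w C \<epsilon> where *: "cmod w = 1" "C > 0" "\<epsilon> > 0" and
    **: "\<And>z. z \<in> bidisc \<Longrightarrow> cmod (fst z - \<tau>) \<le> \<epsilon> \<and> cmod (snd z - w) \<le> \<epsilon> \<longrightarrow>
        cmod ((\<phi>1 \<circ> prod.swap) z - \<alpha>1) \<le> C * cmod (fst z - \<tau>) \<and>
        cmod ((\<phi>2 \<circ> prod.swap) z - \<alpha>2) \<le> C * cmod (fst z - \<tau>)"
    by blast
  have "cmod (\<phi>1 z - \<alpha>1) \<le> C * cmod (snd z - \<tau>) \<and> cmod (\<phi>2 z - \<alpha>2) \<le> C * cmod (snd z - \<tau>)"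
    if "z \<in> bidisc" "cmod (fst z - w) \<le> \<epsilon>" "cmod (snd z - \<tau>) \<le> \<epsilon>" for z
    using **[of "prod.swap z"] that by (simp add: bidisc_swap)
  with * show ?thesis by blast
qed

section \<open>Lower bounds for the norms\<close>

lemma cmod_cis_diff: "cmod (cis s - cis t) = 2 * \<bar>sin ((s - t) / 2)\<bar>"
proof -
  have "cis s - cis t = cis t * (exp (\<i> * of_real (s - t)) - 1)"
    by (simp add: cis_conv_exp exp_add[symmetric] algebra_simps)
  then show ?thesis by (simp only: norm_mult dist_exp_i_1) simp
qed

text \<open>The sign of \<beta> decides which end of the range of \<open>t\<close> is the worst one:
  \<open>t = d\<close> for \<beta> \<ge> 0 and \<open>t = 6 * d\<close> for \<beta> < 0. The minimum
  covers both.\<close>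

lemma powr_ge_min:
  fixes d t \<beta> :: real
  assumes "0 < d" "d \<le> t" "t \<le> 6 * d"
  shows "min 1 (6 powr \<beta>) * d powr \<beta> \<le> t powr \<beta>"
proof (cases "\<beta> \<ge> 0")
  case True
  have "min 1 (6 powr \<beta>) * d powr \<beta> \<le> 1 * d powr \<beta>"
    by (intro mult_right_mono) auto
  also have "\<dots> \<le> t powr \<beta>" using True assms by (simp add: powr_mono2)
  finally show ?thesis .
next
  case False
  have "min 1 (6 powr \<beta>) * d powr \<beta> \<le> 6 powr \<beta> * d powr \<beta>"
    by (intro mult_right_mono) auto
  also have "\<dots> = (6 * d) powr \<beta>" using assms by (simp add: powr_mult)
  also have "\<dots> \<le> t powr \<beta>" using False assms by (intro powr_mono2') auto
  finally show ?thesis .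
qed

lemma sigma_finite_dA: "sigma_finite_measure dA"
  unfolding dA_def
  by (subst sigma_finite_measure.sigma_finite_iff_density_finite[OF sigma_finite_lborel]) auto

interpretation dA: sigma_finite_measure dA by (rule sigma_finite_dA)
interpretation dA_pair: pair_sigma_finite dA dA ..

lemma sets_dA [measurable_cong]: "sets dA = sets borel"
  by (simp add: dA_def)

lemma sets_dV: "sets dV = sets borel"
  unfolding dV_def borel_prod[symmetric] by (intro sets_pair_measure_cong sets_dA)

lemma emeasure_dA_ball:
  assumes "d \<ge> 0"
  shows "emeasure dA (ball (c :: complex) d) = ennreal (d\<^sup>2)"
proof -
  have "emeasure dA (ball c d) = ennreal (1 / pi) * ennreal (pi * d\<^sup>2)"
    unfolding dA_def using emeasure_ball[OF assms, of c]
    by (subst emeasure_density) (simp_all add: nn_integral_cmult_indicator unit_ball_vol_2)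
  also have "\<dots> = ennreal (d\<^sup>2)"
    by (subst ennreal_mult[symmetric]) auto
  finally show ?thesis .
qed

text \<open>Monotonicity of the nonnegative integral suffices, with measurability asked of
  \<open>A\<close> only. Hence it applies to the composed function, which is arbitrary off the
  bidisc.\<close>

lemma nn_integral_indicator_le:
  assumes "A \<in> sets M" "\<And>x. x \<in> A \<Longrightarrow> k \<le> f x"
  shows "k * emeasure M A \<le> (\<integral>\<^sup>+x. f x \<partial>M)"
proof -
  have "k * emeasure M A = (\<integral>\<^sup>+x. k * indicator A x \<partial>M)"
    using assms(1) by (simp add: nn_integral_cmult)
  also have "\<dots> \<le> (\<integral>\<^sup>+x. f x \<partial>M)"
    by (intro nn_integral_mono) (auto simp: assms(2) split: split_indicator)
  finally show ?thesis .
qed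

text \<open>This disc has diameter comparable to its distance from the circle. Its points therefore
  all have weights comparable to a power of \<open>d\<close>, while the disc still lies within
  \<open>3 * d\<close> of the boundary point.\<close>

lemma ball_near_circle:
  assumes "cmod \<zeta> = 1" "0 < d" "d \<le> 1 / 4" "z \<in> ball (of_real (1 - 2 * d) * \<zeta>) d"
  shows "cmod z < 1 - d" "1 - 3 * d < cmod z" "cmod (z - \<zeta>) \<le> 3 * d"
proof -
  let ?c = "of_real (1 - 2 * d) * \<zeta>"
  have c: "cmod ?c = 1 - 2 * d" using assms by (simp only: norm_mult norm_of_real) simp
  have cz: "cmod (?c - \<zeta>) = 2 * d"
  proof -
    have "?c - \<zeta> = of_real (- (2 * d)) * \<zeta>" unfolding of_real_diff of_real_minus by (simp add: algebra_simps)
    then have "cmod (?c - \<zeta>) = cmod (of_real (- (2 * d)) * \<zeta>)" by (rule arg_cong)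
    then show ?thesis using assms by (simp add: norm_mult del: of_real_minus of_real_mult)
  qed
  have zc: "cmod (z - ?c) < d" using assms(4) by (simp add: dist_norm norm_minus_commute)
  show "cmod z < 1 - d" using norm_triangle_sub[of z ?c] c zc by linarith
  show "1 - 3 * d < cmod z" using norm_triangle_sub[of ?c z] c zc by (simp add: norm_minus_commute)
  show "cmod (z - \<zeta>) \<le> 3 * d" using norm_triangle_ineq[of "z - ?c" "?c - \<zeta>"] cz zc by simp
qed

text \<open>In \<open>1 - (cmod z)\<^sup>2 = (1 - cmod z) * (1 + cmod z)\<close> the first factor
  lies between \<open>d\<close> and \<open>3 * d\<close>, the second between 1 and 2; this is the
  origin of the 6.\<close>

lemma weight_near_circle:
  assumes "cmod \<zeta> = 1" "0 < d" "d \<le> 1 / 4" "z \<in> ball (of_real (1 - 2 * d) * \<zeta>) d"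
  shows "min 1 (6 powr \<beta>) * d powr \<beta> \<le> (1 - (cmod z)\<^sup>2) powr \<beta>"
proof (rule powr_ge_min)
  have eq: "1 - (cmod z)\<^sup>2 = (1 - cmod z) * (1 + cmod z)"
    by (simp add: power2_eq_square algebra_simps)
  note b = ball_near_circle[OF assms]
  show "d \<le> 1 - (cmod z)\<^sup>2"
    unfolding eq using mult_mono[of d "1 - cmod z" 1 "1 + cmod z"] b assms(2) by simp
  show "1 - (cmod z)\<^sup>2 \<le> 6 * d"
    unfolding eq using mult_mono[of "1 - cmod z" "3 * d" "1 + cmod z" 2] b assms(2,3) by simp
qed (use assms in auto)

text \<open>On a product of two such discs each coordinate contributes area \<open>d\<^sup>2\<close>
  and weight of order \<open>d powr \<beta>\<close>, whence the exponent \<beta> + 2.\<close>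

lemma bergman_sq_ge:
  assumes \<zeta>: "cmod \<zeta>1 = 1" "cmod \<zeta>2 = 1"
    and d: "0 < d1" "d1 \<le> 1 / 4" "0 < d2" "d2 \<le> 1 / 4" and K: "K \<ge> 0"
    and g: "\<And>z. z \<in> bidisc \<Longrightarrow> cmod (fst z - \<zeta>1) \<le> 3 * d1 \<Longrightarrow> cmod (snd z - \<zeta>2) \<le> 3 * d2 \<Longrightarrow> K \<le> (cmod (g z))\<^sup>2"
  shows "ennreal ((min 1 (6 powr \<beta>))\<^sup>2 * K * d1 powr (\<beta> + 2) * d2 powr (\<beta> + 2)) \<le> bergman_sq \<beta> g"
proof -
  let ?A = "ball (of_real (1 - 2 * d1) * \<zeta>1) d1" and ?B = "ball (of_real (1 - 2 * d2) * \<zeta>2) d2"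
  let ?m = "min 1 (6 powr \<beta>)"
  let ?k = "K * (?m * d1 powr \<beta>) * (?m * d2 powr \<beta>)"
  have m: "?m > 0" by simp
  have "ennreal ?k * emeasure dV (?A \<times> ?B) \<le> bergman_sq \<beta> g"
    unfolding bergman_sq_def
  proof (rule nn_integral_indicator_le)
    show "?A \<times> ?B \<in> sets dV" unfolding sets_dV by (intro borel_open open_Times) auto
    fix z assume "z \<in> ?A \<times> ?B"
    then have z: "fst z \<in> ?A" "snd z \<in> ?B" by auto
    note z1 = ball_near_circle[OF \<zeta>(1) d(1,2) z(1)] and z2 = ball_near_circle[OF \<zeta>(2) d(3,4) z(2)]
    have zb: "z \<in> bidisc" using z1 z2 d by (auto simp: bidisc_def mem_Times_iff)
    have "?k \<le> (cmod (g z))\<^sup>2 * (1 - (cmod (fst z))\<^sup>2) powr \<beta> * (1 - (cmod (snd z))\<^sup>2) powr \<beta>"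
      using g[OF zb z1(3) z2(3)] K m
        weight_near_circle[OF \<zeta>(1) d(1,2) z(1)] weight_near_circle[OF \<zeta>(2) d(3,4) z(2)]
      by (intro mult_mono) auto
    then show "ennreal ?k \<le> ennreal ((cmod (g z))\<^sup>2 * (1 - (cmod (fst z))\<^sup>2) powr \<beta> * (1 - (cmod (snd z))\<^sup>2) powr \<beta>) * indicator bidisc z"
      using zb by (simp add: ennreal_leI)
  qed
  moreover have "emeasure dV (?A \<times> ?B) = ennreal (d1\<^sup>2 * d2\<^sup>2)"
    unfolding dV_def using d
    by (subst dA.emeasure_pair_measure_Times) (simp_all add: emeasure_dA_ball sets_dA ennreal_mult)
  moreover have "?k * (d1\<^sup>2 * d2\<^sup>2) = ?m\<^sup>2 * K * d1 powr (\<beta> + 2) * d2 powr (\<beta> + 2)"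
    using d by (simp add: powr_add power2_eq_square)
  moreover have "ennreal ?k * ennreal (d1\<^sup>2 * d2\<^sup>2) = ennreal (?k * (d1\<^sup>2 * d2\<^sup>2))"
    using K m by (intro ennreal_mult[symmetric]) auto
  ultimately show ?thesis by (simp only:)
qed

text \<open>The angular domain is cut at 0, so the arc starts at the angle of \<zeta> if this is at
  most \<pi> and ends there otherwise. A chord is no longer than its arc.\<close>

lemma arc_near_point:
  assumes "cmod \<zeta> = 1" "0 < d" "d \<le> 1 / 4"
  shows "\<exists>a. {a..a + d} \<subseteq> {0..2 * pi} \<and> (\<forall>\<theta>\<in>{a..a + d}. cmod (cis \<theta> - \<zeta>) \<le> d)"
proof -
  obtain t where t: "0 \<le> t" "t < 2 * pi" "\<zeta> = cis t"
    using complex_unimodular_polar[OF assms(1)] by (metis cis.code)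
  have le: "cmod (cis \<theta> - \<zeta>) \<le> d" if "\<bar>\<theta> - t\<bar> \<le> d" for \<theta>
    using abs_sin_x_le_abs_x[of "(\<theta> - t) / 2"] that unfolding t(3) cmod_cis_diff by simp
  show ?thesis
  proof (cases "t \<le> pi")
    case True
    then show ?thesis
      using t(1) assms(3) pi_gt3 by (intro exI[of _ t]) (auto intro!: le)
  next
    case False
    then show ?thesis
      using t(2) assms(3) pi_gt3 by (intro exI[of _ "t - d"]) (auto intro!: le)
  qed
qed

lemma hardy_sq_ge:
  assumes \<zeta>: "cmod \<zeta>1 = 1" "cmod \<zeta>2 = 1"
    and d: "0 < d1" "d1 \<le> 1 / 4" "0 < d2" "d2 \<le> 1 / 4" and K: "K \<ge> 0"
    and g: "\<And>z. z \<in> bidisc \<Longrightarrow> cmod (fst z - \<zeta>1) \<le> 3 * d1 \<Longrightarrow> cmod (snd z - \<zeta>2) \<le> 3 * d2 \<Longrightarrow> K \<le> (cmod (g z))\<^sup>2"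
  shows "ennreal (1 / (2 * pi)\<^sup>2 * K * d1 * d2) \<le> hardy_sq g"
proof -
  obtain a where a: "{a..a + d1} \<subseteq> {0..2 * pi}" "\<And>\<theta>. \<theta> \<in> {a..a + d1} \<Longrightarrow> cmod (cis \<theta> - \<zeta>1) \<le> d1"
    using arc_near_point[OF \<zeta>(1) d(1,2)] by blast
  obtain b where b: "{b..b + d2} \<subseteq> {0..2 * pi}" "\<And>\<theta>. \<theta> \<in> {b..b + d2} \<Longrightarrow> cmod (cis \<theta> - \<zeta>2) \<le> d2"
    using arc_near_point[OF \<zeta>(2) d(3,4)] by blast
  \<comment> \<open>One radius below the supremum is enough. It has to serve both coordinates, so
    the radial displacement \<open>1 - r\<close> may exceed neither \<open>d1\<close> nor
    \<open>d2\<close>.\<close>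
  define r where "r = 1 - min d1 d2"
  have r: "0 < r" "r < 1" using d by (auto simp: r_def)
  have near: "cmod (of_real r * cis \<theta> - \<zeta>) \<le> 3 * d" if "cmod (cis \<theta> - \<zeta>) \<le> d" "1 - r \<le> d" for \<theta> \<zeta> d
  proof -
    have "cmod (of_real r * cis \<theta> - cis \<theta>) = 1 - r"
    proof -
      have "of_real r * cis \<theta> - cis \<theta> = of_real (- (1 - r)) * cis \<theta>" by (simp add: algebra_simps)
      then show ?thesis using r by (simp only: norm_mult norm_of_real) simp
    qed
    then show ?thesis
      using norm_triangle_ineq[of "of_real r * cis \<theta> - cis \<theta>" "cis \<theta> - \<zeta>"] that r by simp
  qed
  have "ennreal K * emeasure lborel ({a..a + d1} \<times> {b..b + d2}) \<le>
    (\<integral>\<^sup>+\<theta>\<in>{0..2*pi} \<times> {0..2*pi}. ennreal ((cmod (g (of_real r * cis (fst \<theta>), of_real r * cis (snd \<theta>))))\<^sup>2) \<partial>lborel)"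
  proof (rule nn_integral_indicator_le)
    show "{a..a + d1} \<times> {b..b + d2} \<in> sets lborel"
      by (simp add: borel_closed closed_Times)
    fix \<theta> assume "\<theta> \<in> {a..a + d1} \<times> {b..b + d2}"
    then have \<theta>: "fst \<theta> \<in> {a..a + d1}" "snd \<theta> \<in> {b..b + d2}" by auto
    have "K \<le> (cmod (g (of_real r * cis (fst \<theta>), of_real r * cis (snd \<theta>))))\<^sup>2"
    proof (rule g)
      show "(of_real r * cis (fst \<theta>), of_real r * cis (snd \<theta>)) \<in> bidisc"
        using r by (simp add: bidisc_def norm_mult)
      show "cmod (fst (of_real r * cis (fst \<theta>), of_real r * cis (snd \<theta>)) - \<zeta>1) \<le> 3 * d1"
        unfolding fst_conv by (rule near[OF a(2)[OF \<theta>(1)]]) (simp add: r_def)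
      show "cmod (snd (of_real r * cis (fst \<theta>), of_real r * cis (snd \<theta>)) - \<zeta>2) \<le> 3 * d2"
        unfolding snd_conv by (rule near[OF b(2)[OF \<theta>(2)]]) (simp add: r_def)
    qed
    moreover have "\<theta> \<in> {0..2*pi} \<times> {0..2*pi}" using \<theta> a(1) b(1) by (auto simp: mem_Times_iff)
    ultimately show "ennreal K \<le> ennreal ((cmod (g (of_real r * cis (fst \<theta>), of_real r * cis (snd \<theta>))))\<^sup>2) * indicator ({0..2*pi} \<times> {0..2*pi}) \<theta>"
      by (simp add: ennreal_leI)
  qed
  then have "ennreal (1 / (2 * pi)\<^sup>2) * (ennreal K * emeasure lborel ({a..a + d1} \<times> {b..b + d2})) \<le> hardy_sq g"
    unfolding hardy_sq_def using r by (intro SUP_upper2[of r] mult_left_mono) auto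
  moreover have "emeasure lborel ({a..a + d1} \<times> {b..b + d2}) = ennreal (d1 * d2)"
    using d by (simp add: lborel_prod[symmetric] lborel.emeasure_pair_measure_Times ennreal_mult)
  moreover have "ennreal (1 / (2 * pi)\<^sup>2) * (ennreal K * ennreal (d1 * d2)) = ennreal (1 / (2 * pi)\<^sup>2 * K * d1 * d2)"
    using K d by (simp add: ennreal_mult[symmetric] mult.assoc)
  ultimately show ?thesis by simp
qed

text \<open>For \<beta> = -1 the exponent \<beta> + 2 is 1, so the Hardy bound by arc lengths takes
  the same form as the Bergman bound. From here on the blow-up is treated uniformly in \<beta>, with
  \<open>c\<close> depending on \<beta> alone.\<close>

lemma A2_sq_ge:
  obtains c where "c > 0"
    "\<And>\<zeta>1 \<zeta>2 d1 d2 K g. \<lbrakk>cmod \<zeta>1 = 1; cmod \<zeta>2 = 1; 0 < d1; d1 \<le> 1 / 4; 0 < d2; d2 \<le> 1 / 4; K \<ge> 0;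
        \<And>z. z \<in> bidisc \<Longrightarrow> cmod (fst z - \<zeta>1) \<le> 3 * d1 \<Longrightarrow> cmod (snd z - \<zeta>2) \<le> 3 * d2 \<Longrightarrow> K \<le> (cmod (g z))\<^sup>2\<rbrakk> \<Longrightarrow>
      ennreal (c * K * d1 powr (\<beta> + 2) * d2 powr (\<beta> + 2)) \<le> A2_sq \<beta> g"
proof (cases "\<beta> = -1")
  case True
  have "x powr (\<beta> + 2) = x" if "0 < x" for x :: real using True that by simp
  moreover have "A2_sq \<beta> g = hardy_sq g" for g using True by (simp add: A2_sq_def)
  ultimately show ?thesis
    using that[of "1 / (2 * pi)\<^sup>2"] hardy_sq_ge by simp
next
  case False
  then have "A2_sq \<beta> g = bergman_sq \<beta> g" for g by (simp add: A2_sq_def)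
  moreover have "(min 1 (6 powr \<beta>))\<^sup>2 > (0 :: real)" by (intro zero_less_power) simp
  ultimately show ?thesis
    using that[of "(min 1 (6 powr \<beta>))\<^sup>2"] bergman_sq_ge by simp
qed

section \<open>Integrals of powers over the disc and the circle\<close>

lemma nn_integral_powr_abs_finite:
  fixes \<gamma> b l u :: real
  assumes "\<gamma> > -1"
  shows "(\<integral>\<^sup>+x\<in>{l..u}. ennreal (\<bar>x - b\<bar> powr \<gamma>) \<partial>lborel) < \<infinity>"
proof -
  \<comment> \<open>Large enough that the truncated one-sided power \<open>P\<close>, placed at
    \<open>b\<close> in both directions, covers all of \<open>{l..u}\<close>.\<close>
  define R where "R = \<bar>l - b\<bar> + \<bar>u - b\<bar>"
  define P where "P x = (if x \<in> {0..R} then x powr \<gamma> else 0)" for x :: real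
  have [measurable]: "P \<in> borel_measurable borel" unfolding P_def by measurable
  have "(P has_integral (R powr (\<gamma> + 1) / (\<gamma> + 1))) UNIV"
    using has_integral_powr_from_0[OF assms, of R] unfolding P_def has_integral_restrict_UNIV
    by (simp add: R_def)
  then have fin: "(\<integral>\<^sup>+x. ennreal (P x) \<partial>lborel) < \<infinity>"
    by (subst nn_integral_has_integral_lborel) (auto simp: P_def)
  have 1: "(\<integral>\<^sup>+x. ennreal (P (x - b)) \<partial>lborel) < \<infinity>"
    using fin by (subst (asm) nn_integral_real_affine[where t = "- b" and c = 1]) (auto simp: algebra_simps)
  have 2: "(\<integral>\<^sup>+x. ennreal (P (b - x)) \<partial>lborel) < \<infinity>"
    using fin by (subst (asm) nn_integral_real_affine[where t = b and c = "-1"]) (auto simp: algebra_simps)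
  have "(\<integral>\<^sup>+x\<in>{l..u}. ennreal (\<bar>x - b\<bar> powr \<gamma>) \<partial>lborel) \<le> (\<integral>\<^sup>+x. ennreal (P (x - b)) + ennreal (P (b - x)) \<partial>lborel)"
    by (intro nn_integral_mono) (auto simp: P_def R_def abs_if split: split_indicator)
  also have "\<dots> = (\<integral>\<^sup>+x. ennreal (P (x - b)) \<partial>lborel) + (\<integral>\<^sup>+x. ennreal (P (b - x)) \<partial>lborel)"
    by (intro nn_integral_add) auto
  also have "\<dots> < \<infinity>" using 1 2 by simp
  finally show ?thesis .
qed

text \<open>\<open>1 - t\<^sup>2\<close> is at least \<open>1 - \<bar>t\<bar>\<close>, the distance
  to the nearer endpoint. Adding the powers for both endpoints removes the case distinction, and
  \<open>t - (-1)\<close> matches the form of the one-point integral.\<close>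

lemma one_minus_square_powr_le:
  fixes t \<gamma> :: real
  assumes "\<bar>t\<bar> < 1" "\<gamma> \<le> 0"
  shows "(1 - t\<^sup>2) powr \<gamma> \<le> \<bar>t - 1\<bar> powr \<gamma> + \<bar>t - (-1)\<bar> powr \<gamma>"
proof -
  have le: "(1 - t\<^sup>2) powr \<gamma> \<le> (1 - \<bar>t\<bar>) powr \<gamma>"
  proof (rule powr_mono2'[OF assms(2)])
    have "\<bar>t\<bar> * \<bar>t\<bar> \<le> 1 * \<bar>t\<bar>" using assms(1) by (intro mult_right_mono) auto
    then show "1 - \<bar>t\<bar> \<le> 1 - t\<^sup>2" by (simp add: power2_eq_square)
  qed (use assms in auto)
  show ?thesis
  proof (cases "t \<ge> 0")
    case True
    then have "\<bar>t - 1\<bar> = 1 - \<bar>t\<bar>" using assms by auto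
    then show ?thesis using le by (simp add: add_increasing2)
  next
    case False
    then have "\<bar>t - (-1)\<bar> = 1 - \<bar>t\<bar>" using assms by auto
    then show ?thesis using le by (simp add: add_increasing)
  qed
qed

lemma nn_integral_one_minus_square_finite:
  fixes \<gamma> :: real
  assumes "-1 < \<gamma>" "\<gamma> \<le> 0"
  shows "(\<integral>\<^sup>+t\<in>{-1<..<1}. ennreal ((1 - t\<^sup>2) powr \<gamma>) \<partial>lborel) < \<infinity>"
proof -
  have "(\<integral>\<^sup>+t\<in>{-1<..<1}. ennreal ((1 - t\<^sup>2) powr \<gamma>) \<partial>lborel)
      \<le> (\<integral>\<^sup>+t. ennreal (\<bar>t - 1\<bar> powr \<gamma>) * indicator {-1..1} t + ennreal (\<bar>t - (-1)\<bar> powr \<gamma>) * indicator {-1..1} t \<partial>lborel)"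
  proof (rule nn_integral_mono)
    fix t :: real
    show "ennreal ((1 - t\<^sup>2) powr \<gamma>) * indicator {-1<..<1} t \<le>
        ennreal (\<bar>t - 1\<bar> powr \<gamma>) * indicator {-1..1} t + ennreal (\<bar>t - (-1)\<bar> powr \<gamma>) * indicator {-1..1} t"
    proof (cases "\<bar>t\<bar> < 1")
      case True
      then have "indicator {-1..1} t = (1 :: ennreal)" "indicator {-1<..<1} t = (1 :: ennreal)"
        by (simp_all add: indicator_def abs_less_iff)
      then show ?thesis
        using one_minus_square_powr_le[OF True assms(2)] by (simp add: ennreal_leI ennreal_plus[symmetric] del: ennreal_plus)
    next
      case False
      then have "indicator {-1<..<1} t = (0 :: ennreal)" by (auto simp: indicator_def)
      then show ?thesis by simp
    qed
  qed
  also have "\<dots> = (\<integral>\<^sup>+t\<in>{-1..1}. ennreal (\<bar>t - 1\<bar> powr \<gamma>) \<partial>lborel) + (\<integral>\<^sup>+t\<in>{-1..1}. ennreal (\<bar>t - (-1)\<bar> powr \<gamma>) \<partial>lborel)"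
    by (intro nn_integral_add) auto
  also have "\<dots> < \<infinity>"
    using nn_integral_powr_abs_finite[OF assms(1), where l = "-1" and u = 1 and b = 1]
      nn_integral_powr_abs_finite[OF assms(1), where l = "-1" and u = 1 and b = "-1"] by simp
  finally show ?thesis .
qed

text \<open>With the half chord \<open>s = sqrt (1 - v\<^sup>2)\<close>, the substitution
  \<open>u = s * t\<close> turns \<open>1 - u\<^sup>2 - v\<^sup>2\<close> into
  \<open>s\<^sup>2 * (1 - t\<^sup>2)\<close> and produces the factor
  \<open>s powr (2 * \<gamma> + 1)\<close>. Since the exponent exceeds -1 and
  \<open>s \<le> 1\<close>, this is at most \<open>1 / s\<close>.\<close>

lemma nn_integral_chord_le:
  fixes v \<gamma> :: real
  assumes v: "\<bar>v\<bar> < 1" and \<gamma>: "-1 < \<gamma>" "\<gamma> \<le> 0"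
  shows "(\<integral>\<^sup>+u. ennreal ((1 - u\<^sup>2 - v\<^sup>2) powr \<gamma>) * indicator {u. u\<^sup>2 + v\<^sup>2 < 1} u \<partial>lborel)
    \<le> ennreal ((1 - v\<^sup>2) powr (- 1 / 2)) * (\<integral>\<^sup>+t\<in>{-1<..<1}. ennreal ((1 - t\<^sup>2) powr \<gamma>) \<partial>lborel)"
proof -
  have v2: "0 < 1 - v\<^sup>2" "1 - v\<^sup>2 \<le> 1" using v by (auto simp: abs_square_less_1)
  define s where "s = sqrt (1 - v\<^sup>2)"
  have s: "0 < s" "s\<^sup>2 = 1 - v\<^sup>2" "s \<le> 1" using v2 by (auto simp: s_def)
  have sm: "{u. u\<^sup>2 + v\<^sup>2 < 1} \<in> sets borel" by measurable
  have "(\<integral>\<^sup>+u. ennreal ((1 - u\<^sup>2 - v\<^sup>2) powr \<gamma>) * indicator {u. u\<^sup>2 + v\<^sup>2 < 1} u \<partial>lborel)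
     = ennreal s * (\<integral>\<^sup>+t. ennreal ((1 - (s * t)\<^sup>2 - v\<^sup>2) powr \<gamma>) * indicator {u. u\<^sup>2 + v\<^sup>2 < 1} (s * t) \<partial>lborel)"
    using s(1) sm by (subst nn_integral_real_affine[where t = 0 and c = s]) auto
  also have "(\<integral>\<^sup>+t. ennreal ((1 - (s * t)\<^sup>2 - v\<^sup>2) powr \<gamma>) * indicator {u. u\<^sup>2 + v\<^sup>2 < 1} (s * t) \<partial>lborel)
     = (\<integral>\<^sup>+t. ennreal (s powr (2 * \<gamma>)) * (ennreal ((1 - t\<^sup>2) powr \<gamma>) * indicator {-1<..<1} t) \<partial>lborel)"
  proof (intro nn_integral_cong)
    fix t :: real
    have e: "1 - (s * t)\<^sup>2 - v\<^sup>2 = s\<^sup>2 * (1 - t\<^sup>2)" using s(2) by (simp add: power_mult_distrib algebra_simps)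
    have "(s * t)\<^sup>2 + v\<^sup>2 < 1 \<longleftrightarrow> 0 < s\<^sup>2 * (1 - t\<^sup>2)" unfolding e[symmetric] by linarith
    also have "\<dots> \<longleftrightarrow> t\<^sup>2 < 1" using s(1) by (simp add: zero_less_mult_iff)
    finally have iff: "(s * t)\<^sup>2 + v\<^sup>2 < 1 \<longleftrightarrow> \<bar>t\<bar> < 1" by (simp only: abs_square_less_1)
    show "ennreal ((1 - (s * t)\<^sup>2 - v\<^sup>2) powr \<gamma>) * indicator {u. u\<^sup>2 + v\<^sup>2 < 1} (s * t)
        = ennreal (s powr (2 * \<gamma>)) * (ennreal ((1 - t\<^sup>2) powr \<gamma>) * indicator {-1<..<1} t)"
    proof (cases "\<bar>t\<bar> < 1")
      case True
      have "t\<^sup>2 < 1" using True by (simp add: abs_square_less_1)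
      moreover have "s\<^sup>2 powr \<gamma> = s powr (2 * \<gamma>)"
        using s(1) powr_powr[of s 2 \<gamma>] by simp
      ultimately have "(s\<^sup>2 * (1 - t\<^sup>2)) powr \<gamma> = s powr (2 * \<gamma>) * (1 - t\<^sup>2) powr \<gamma>"
        using s(1) by (subst powr_mult) auto
      moreover have "indicator {u. u\<^sup>2 + v\<^sup>2 < 1} (s * t) = (1 :: ennreal)" "indicator {-1<..<1} t = (1 :: ennreal)"
        using True iff by (simp_all add: indicator_def abs_less_iff)
      ultimately show ?thesis by (simp add: e ennreal_mult)
    next
      case False
      then have "indicator {u. u\<^sup>2 + v\<^sup>2 < 1} (s * t) = (0 :: ennreal)" "indicator {-1<..<1} t = (0 :: ennreal)"
        using iff by (auto simp: indicator_def)
      then show ?thesis by simp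
    qed
  qed
  also have "\<dots> = ennreal (s powr (2 * \<gamma>)) * (\<integral>\<^sup>+t\<in>{-1<..<1}. ennreal ((1 - t\<^sup>2) powr \<gamma>) \<partial>lborel)"
    by (intro nn_integral_cmult) auto
  also have "ennreal s * \<dots> = ennreal (s powr (2 * \<gamma> + 1)) * (\<integral>\<^sup>+t\<in>{-1<..<1}. ennreal ((1 - t\<^sup>2) powr \<gamma>) \<partial>lborel)"
    using s(1) by (simp add: powr_add mult.assoc[symmetric] ennreal_mult'[symmetric] mult.commute[of s])
  also have "\<dots> \<le> ennreal ((1 - v\<^sup>2) powr (- 1 / 2)) * (\<integral>\<^sup>+t\<in>{-1<..<1}. ennreal ((1 - t\<^sup>2) powr \<gamma>) \<partial>lborel)"
  proof (intro mult_right_mono ennreal_leI)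
    have "s powr (2 * \<gamma> + 1) \<le> s powr (- 1)" using s \<gamma> by (intro powr_mono') auto
    also have "\<dots> = ((1 - v\<^sup>2) powr (1 / 2)) powr (- 1)" using v2 by (simp add: s_def powr_half_sqrt)
    finally show "s powr (2 * \<gamma> + 1) \<le> (1 - v\<^sup>2) powr (- 1 / 2)" by (simp add: powr_powr powr_minus_divide)
  qed simp
  finally show ?thesis .
qed

text \<open>The bound on \<open>b\<close> keeps the singularity at \<open>b\<close> away from those
  at -1 and 1; if they met, the exponents would add up to -5/4, which is not integrable. For
  \<open>\<bar>v\<bar> \<le> 7 / 8\<close> one has \<open>1 - v\<^sup>2 \<ge> 1 / 8\<close>,
  otherwise \<open>\<bar>v - b\<bar> \<ge> 1 / 8\<close>, so in each region one factor is
  bounded.\<close>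

lemma nn_integral_chord_weight_finite:
  fixes b :: real
  assumes b: "\<bar>b\<bar> \<le> 3 / 4"
  shows "(\<integral>\<^sup>+v\<in>{-1<..<1}. ennreal ((1 - v\<^sup>2) powr (- 1 / 2) * \<bar>v - b\<bar> powr (- 3 / 4)) \<partial>lborel) < \<infinity>"
proof -
  let ?h = "\<lambda>v. ennreal ((1 / 8) powr (- 1 / 2)) * (ennreal (\<bar>v - b\<bar> powr (- 3 / 4)) * indicator {-1..1} v) +
      ennreal ((1 / 8) powr (- 3 / 4)) * (ennreal ((1 - v\<^sup>2) powr (- 1 / 2)) * indicator {-1<..<1} v)"
  have "(\<integral>\<^sup>+v\<in>{-1<..<1}. ennreal ((1 - v\<^sup>2) powr (- 1 / 2) * \<bar>v - b\<bar> powr (- 3 / 4)) \<partial>lborel) \<le> (\<integral>\<^sup>+v. ?h v \<partial>lborel)"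
  proof (rule nn_integral_mono)
    fix v :: real
    show "ennreal ((1 - v\<^sup>2) powr (- 1 / 2) * \<bar>v - b\<bar> powr (- 3 / 4)) * indicator {-1<..<1} v \<le> ?h v"
    proof (cases "\<bar>v\<bar> < 1")
      case True
      then have ind: "indicator {-1..1} v = (1 :: ennreal)" "indicator {-1<..<1} v = (1 :: ennreal)"
        by (simp_all add: indicator_def abs_less_iff)
      have "(1 - v\<^sup>2) powr (- 1 / 2) * \<bar>v - b\<bar> powr (- 3 / 4)
        \<le> (1 / 8) powr (- 1 / 2) * \<bar>v - b\<bar> powr (- 3 / 4) + (1 / 8) powr (- 3 / 4) * (1 - v\<^sup>2) powr (- 1 / 2)"
      proof (cases "\<bar>v\<bar> \<le> 7 / 8")
        case True
        have "\<bar>v\<bar>\<^sup>2 \<le> (7 / 8)\<^sup>2" using True by (intro power_mono) auto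
        then have "(1 - v\<^sup>2) powr (- 1 / 2) \<le> (1 / 8) powr (- 1 / 2)"
          by (intro powr_mono2') (auto simp: power2_eq_square)
        then show ?thesis by (intro add_increasing2 mult_right_mono) auto
      next
        case False
        then have "1 / 8 \<le> \<bar>v - b\<bar>" using b by linarith
        then have "\<bar>v - b\<bar> powr (- 3 / 4) \<le> (1 / 8) powr (- 3 / 4)"
          by (intro powr_mono2') auto
        then have "(1 - v\<^sup>2) powr (- 1 / 2) * \<bar>v - b\<bar> powr (- 3 / 4) \<le> (1 - v\<^sup>2) powr (- 1 / 2) * (1 / 8) powr (- 3 / 4)"
          by (intro mult_left_mono) auto
        then show ?thesis by (intro add_increasing) (auto simp: mult.commute)
      qed
      then have "ennreal ((1 - v\<^sup>2) powr (- 1 / 2) * \<bar>v - b\<bar> powr (- 3 / 4))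
        \<le> ennreal ((1 / 8) powr (- 1 / 2)) * ennreal (\<bar>v - b\<bar> powr (- 3 / 4)) + ennreal ((1 / 8) powr (- 3 / 4)) * ennreal ((1 - v\<^sup>2) powr (- 1 / 2))"
        by (simp add: ennreal_leI ennreal_plus[symmetric] ennreal_mult[symmetric] del: ennreal_plus)
      then show ?thesis unfolding ind by (simp only: mult_1_right)
    next
      case False
      then have "indicator {-1<..<1} v = (0 :: ennreal)" by (auto simp: indicator_def)
      then show ?thesis by simp
    qed
  qed
  also have "\<dots> = ennreal ((1 / 8) powr (- 1 / 2)) * (\<integral>\<^sup>+v\<in>{-1..1}. ennreal (\<bar>v - b\<bar> powr (- 3 / 4)) \<partial>lborel)
      + ennreal ((1 / 8) powr (- 3 / 4)) * (\<integral>\<^sup>+v\<in>{-1<..<1}. ennreal ((1 - v\<^sup>2) powr (- 1 / 2)) \<partial>lborel)"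
    by (subst nn_integral_add) (auto simp: nn_integral_cmult)
  also have "\<dots> < \<infinity>"
    using nn_integral_powr_abs_finite[where \<gamma> = "- 3 / 4" and l = "-1" and u = 1 and b = b] nn_integral_one_minus_square_finite[of "- 1 / 2"]
    by (simp add: ennreal_mult_less_top)
  finally show ?thesis .
qed

lemma nn_integral_disc_weight_finite:
  fixes b \<gamma> :: real
  assumes b: "\<bar>b\<bar> \<le> 3 / 4" and \<gamma>: "-1 < \<gamma>" "\<gamma> \<le> 0"
  shows "(\<integral>\<^sup>+v. \<integral>\<^sup>+u. ennreal ((1 - u\<^sup>2 - v\<^sup>2) powr \<gamma> * \<bar>v - b\<bar> powr (- 3 / 4)) * indicator {u. u\<^sup>2 + v\<^sup>2 < 1} u \<partial>lborel \<partial>lborel) < \<infinity>"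
proof -
  let ?I = "\<integral>\<^sup>+t\<in>{-1<..<1}. ennreal ((1 - t\<^sup>2) powr \<gamma>) \<partial>lborel"
  have "(\<integral>\<^sup>+u. ennreal ((1 - u\<^sup>2 - v\<^sup>2) powr \<gamma> * \<bar>v - b\<bar> powr (- 3 / 4)) * indicator {u. u\<^sup>2 + v\<^sup>2 < 1} u \<partial>lborel)
      \<le> ?I * (ennreal ((1 - v\<^sup>2) powr (- 1 / 2) * \<bar>v - b\<bar> powr (- 3 / 4)) * indicator {-1<..<1} v)" for v :: real
  proof (cases "\<bar>v\<bar> < 1")
    case True
    have [measurable]: "{u. u\<^sup>2 + v\<^sup>2 < 1} \<in> sets borel" by measurable
    have "(\<integral>\<^sup>+u. ennreal ((1 - u\<^sup>2 - v\<^sup>2) powr \<gamma> * \<bar>v - b\<bar> powr (- 3 / 4)) * indicator {u. u\<^sup>2 + v\<^sup>2 < 1} u \<partial>lborel)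
       = (\<integral>\<^sup>+u. ennreal (\<bar>v - b\<bar> powr (- 3 / 4)) * (ennreal ((1 - u\<^sup>2 - v\<^sup>2) powr \<gamma>) * indicator {u. u\<^sup>2 + v\<^sup>2 < 1} u) \<partial>lborel)"
      by (simp add: ennreal_mult mult_ac)
    also have "\<dots> = ennreal (\<bar>v - b\<bar> powr (- 3 / 4)) * (\<integral>\<^sup>+u. ennreal ((1 - u\<^sup>2 - v\<^sup>2) powr \<gamma>) * indicator {u. u\<^sup>2 + v\<^sup>2 < 1} u \<partial>lborel)"
      by (intro nn_integral_cmult) measurable
    also have "\<dots> \<le> ennreal (\<bar>v - b\<bar> powr (- 3 / 4)) * (ennreal ((1 - v\<^sup>2) powr (- 1 / 2)) * ?I)"
      by (intro mult_left_mono nn_integral_chord_le True \<gamma>) simp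
    finally show ?thesis using True by (simp add: ennreal_mult mult_ac abs_less_iff)
  next
    case False
    then have "1 \<le> v\<^sup>2" using abs_square_less_1[of v] by linarith
    then have "\<not> u\<^sup>2 + v\<^sup>2 < 1" for u using zero_le_power2[of u] by linarith
    then show ?thesis by simp
  qed
  then have "(\<integral>\<^sup>+v. \<integral>\<^sup>+u. ennreal ((1 - u\<^sup>2 - v\<^sup>2) powr \<gamma> * \<bar>v - b\<bar> powr (- 3 / 4)) * indicator {u. u\<^sup>2 + v\<^sup>2 < 1} u \<partial>lborel \<partial>lborel)
     \<le> (\<integral>\<^sup>+v. ?I * (ennreal ((1 - v\<^sup>2) powr (- 1 / 2) * \<bar>v - b\<bar> powr (- 3 / 4)) * indicator {-1<..<1} v) \<partial>lborel)"
    by (intro nn_integral_mono)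
  also have "\<dots> = ?I * (\<integral>\<^sup>+v\<in>{-1<..<1}. ennreal ((1 - v\<^sup>2) powr (- 1 / 2) * \<bar>v - b\<bar> powr (- 3 / 4)) \<partial>lborel)"
    by (intro nn_integral_cmult) measurable
  also have "\<dots> < \<infinity>"
    using nn_integral_chord_weight_finite[OF b] nn_integral_one_minus_square_finite[OF \<gamma>]
    by (simp add: ennreal_mult_less_top)
  finally show ?thesis .
qed

section \<open>Distance to a point of the circle in angular coordinates\<close>

lemma half_le_sin:
  assumes "0 \<le> x" "x \<le> pi / 2"
  shows "x / 2 \<le> sin x"
proof -
  let ?f = "\<lambda>y. sin y - y * cos y"
  \<comment> \<open>This is \<open>y \<le> tan y\<close> at \<open>y = x / 2\<close> without the
    denominator. Multiplied by \<open>cos (x / 2)\<close>, the double-angle formulas turn it into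
    \<open>x * (1 + cos x) \<le> 2 * sin x\<close>, from which the nonnegative
    \<open>x * cos x\<close> is dropped.\<close>
  have "?f 0 \<le> ?f (x / 2)"
  proof (rule DERIV_nonneg_imp_nondecreasing[where f = ?f])
    fix y assume y: "0 \<le> y" "y \<le> x / 2"
    have "DERIV ?f y :> y * sin y" by (auto intro!: derivative_eq_intros)
    moreover have "0 \<le> y * sin y" using y assms by (intro mult_nonneg_nonneg sin_ge_zero) auto
    ultimately show "\<exists>D. DERIV ?f y :> D \<and> 0 \<le> D" by blast
  qed (use assms in simp)
  moreover have "0 \<le> cos (x / 2)" using assms by (intro cos_ge_zero) auto
  ultimately have "(x / 2 * cos (x / 2)) * cos (x / 2) \<le> sin (x / 2) * cos (x / 2)"
    by (intro mult_right_mono) auto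
  also have "\<dots> = sin x / 2" using sin_double[of "x / 2"] by simp
  finally have "x * (2 * (cos (x / 2))\<^sup>2) \<le> 2 * sin x" by (simp add: power2_eq_square algebra_simps)
  moreover have "2 * (cos (x / 2))\<^sup>2 = 1 + cos x" using cos_double_cos[of "x / 2"] by simp
  ultimately have "x * (1 + cos x) \<le> 2 * sin x" by simp
  moreover have "0 \<le> x * cos x" using assms by (intro mult_nonneg_nonneg cos_ge_zero) auto
  ultimately show ?thesis by (simp add: algebra_simps)
qed

lemma half_min_le_sin:
  assumes "0 \<le> x" "x \<le> pi"
  shows "min x (pi - x) / 2 \<le> sin x"
proof (cases "x \<le> pi / 2")
  case True
  then show ?thesis using half_le_sin[of x] assms by auto
next
  case False
  then show ?thesis using half_le_sin[of "pi - x"] assms by auto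
qed

text \<open>Angles are periodic, so the representative of \<open>t\<close> nearest to \<theta> may
  be a translate by a full turn. Uniformity in \<open>r\<close> comes from
  \<open>1 - r \<le> cmod (cis t - of_real r * cis \<theta>)\<close>: moving radially out to the
  circle at most doubles the distance. The 4 combines this 2 with the halving of the angle in the
  chord formula.\<close>

lemma cmod_diff_cis_ge:
  assumes t: "0 \<le> t" "t \<le> 2 * pi" and \<theta>: "0 \<le> \<theta>" "\<theta> \<le> 2 * pi" and r: "0 < r" "r < 1"
  shows "\<exists>b\<in>{t, t - 2 * pi, t + 2 * pi}. \<bar>\<theta> - b\<bar> / 4 \<le> cmod (cis t - of_real r * cis \<theta>)"
proof -
  define x where "x = \<bar>t - \<theta>\<bar> / 2"
  have x: "0 \<le> x" "x \<le> pi" using t \<theta> by (auto simp: x_def)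
  have "x = (t - \<theta>) / 2 \<or> x = - ((t - \<theta>) / 2)"
    unfolding x_def by (cases "t \<ge> \<theta>") (auto simp: field_simps)
  then have "\<bar>sin ((t - \<theta>) / 2)\<bar> = \<bar>sin x\<bar>" by (metis abs_minus_cancel sin_minus)
  also have "\<dots> = sin x" using sin_ge_zero[OF x] by simp
  finally have "\<bar>sin ((t - \<theta>) / 2)\<bar> = sin x" .
  then have "min x (pi - x) \<le> cmod (cis t - cis \<theta>)"
    using half_min_le_sin[OF x] by (simp add: cmod_cis_diff)
  moreover have "cmod (cis t - cis \<theta>) \<le> 2 * cmod (cis t - of_real r * cis \<theta>)"
  proof -
    have 1: "cmod (of_real r * cis \<theta> - cis \<theta>) = 1 - r"
    proof -
      have "of_real r * cis \<theta> - cis \<theta> = of_real (- (1 - r)) * cis \<theta>" by (simp add: algebra_simps)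
      then have "cmod (of_real r * cis \<theta> - cis \<theta>) = cmod (of_real (- (1 - r)) * cis \<theta>)" by (rule arg_cong)
      then show ?thesis using r by (simp add: norm_mult del: of_real_minus of_real_diff of_real_mult)
    qed
    have 2: "1 - r \<le> cmod (cis t - of_real r * cis \<theta>)"
      using norm_triangle_ineq2[of "cis t" "of_real r * cis \<theta>"] r by (simp add: norm_mult)
    show ?thesis
      using norm_triangle_ineq[of "cis t - of_real r * cis \<theta>" "of_real r * cis \<theta> - cis \<theta>"] 1 2 by simp
  qed
  ultimately have m: "min x (pi - x) / 2 \<le> cmod (cis t - of_real r * cis \<theta>)" by simp
  show ?thesis
  proof (cases "x \<le> pi - x")
    case True
    then have "\<bar>\<theta> - t\<bar> / 4 \<le> cmod (cis t - of_real r * cis \<theta>)" using m by (simp add: x_def)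
    then show ?thesis by blast
  next
    case False
    then have le: "(pi - x) / 2 \<le> cmod (cis t - of_real r * cis \<theta>)" using m by (simp add: min_def)
    show ?thesis
    proof (cases "t \<ge> \<theta>")
      case True
      then have "\<bar>\<theta> - (t - 2 * pi)\<bar> / 4 = (pi - x) / 2" using t \<theta> by (simp add: x_def field_simps)
      then show ?thesis using le by (metis insertI1 insertI2)
    next
      case False
      then have "\<bar>\<theta> - (t + 2 * pi)\<bar> / 4 = (pi - x) / 2" using t \<theta> by (simp add: x_def field_simps)
      then show ?thesis using le by (metis insertI1 insertI2)
    qed
  qed
qed

text \<open>A bound uniform in \<open>r\<close> is what the supremum in \<open>hardy_sq\<close>
  calls for. Summing over the three candidate angles avoids choosing one of them measurably.\<close>

lemma circle_integral_bounded:
  assumes "cmod \<alpha> = 1"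
  obtains C where "C < \<infinity>"
    "\<And>r. 0 < r \<Longrightarrow> r < 1 \<Longrightarrow> (\<integral>\<^sup>+\<theta>\<in>{0..2*pi}. ennreal (cmod (\<alpha> - of_real r * cis \<theta>) powr (- 3 / 4)) \<partial>lborel) \<le> C"
proof -
  obtain t where t: "0 \<le> t" "t < 2 * pi" "\<alpha> = cis t"
    using complex_unimodular_polar[OF assms] by (metis cis.code)
  let ?B = "{t, t - 2 * pi, t + 2 * pi}"
  define k :: real where "k = (1 / 4) powr (- 3 / 4)"
  define C where "C = (\<Sum>b\<in>?B. ennreal k * (\<integral>\<^sup>+\<theta>\<in>{0..2*pi}. ennreal (\<bar>\<theta> - b\<bar> powr (- 3 / 4)) \<partial>lborel))"
  show ?thesis
  proof (rule that)
    show "C < \<infinity>" unfolding C_def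
      using nn_integral_powr_abs_finite[where \<gamma> = "- 3 / 4"] by (simp add: ennreal_mult_less_top)
    fix r :: real assume r: "0 < r" "r < 1"
    \<comment> \<open>Since \<open>0 powr a = 0\<close>, a summand of the majorant drops to 0
      exactly at its singularity, and the comparison by a negative power is only available off these
      points.\<close>
    have ae: "AE \<theta> in lborel. \<theta> \<noteq> t \<and> \<theta> \<noteq> t - 2 * pi \<and> \<theta> \<noteq> t + 2 * pi"
      by (intro AE_conjI AE_lborel_singleton)
    have "(\<integral>\<^sup>+\<theta>\<in>{0..2*pi}. ennreal (cmod (\<alpha> - of_real r * cis \<theta>) powr (- 3 / 4)) \<partial>lborel)
      \<le> (\<integral>\<^sup>+\<theta>. (\<Sum>b\<in>?B. ennreal k * (ennreal (\<bar>\<theta> - b\<bar> powr (- 3 / 4)) * indicator {0..2*pi} \<theta>)) \<partial>lborel)"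
    proof (rule nn_integral_mono_AE, rule AE_mp[OF ae], rule AE_I2, rule impI)
      fix \<theta> assume ne: "\<theta> \<noteq> t \<and> \<theta> \<noteq> t - 2 * pi \<and> \<theta> \<noteq> t + 2 * pi"
      show "ennreal (cmod (\<alpha> - of_real r * cis \<theta>) powr (- 3 / 4)) * indicator {0..2*pi} \<theta>
        \<le> (\<Sum>b\<in>?B. ennreal k * (ennreal (\<bar>\<theta> - b\<bar> powr (- 3 / 4)) * indicator {0..2*pi} \<theta>))"
      proof (cases "\<theta> \<in> {0..2*pi}")
        case True
        then have "\<exists>b\<in>?B. \<bar>\<theta> - b\<bar> / 4 \<le> cmod (cis t - of_real r * cis \<theta>)"
          using t r by (intro cmod_diff_cis_ge) auto
        then obtain b where b: "b \<in> ?B" "\<bar>\<theta> - b\<bar> / 4 \<le> cmod (cis t - of_real r * cis \<theta>)"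
          by blast
        have "cmod (\<alpha> - of_real r * cis \<theta>) powr (- 3 / 4) \<le> (\<bar>\<theta> - b\<bar> / 4) powr (- 3 / 4)"
          unfolding t(3) using b ne by (intro powr_mono2') auto
        also have "\<dots> = k * \<bar>\<theta> - b\<bar> powr (- 3 / 4)"
          unfolding k_def by (subst powr_mult[symmetric]) auto
        finally have "ennreal (cmod (\<alpha> - of_real r * cis \<theta>) powr (- 3 / 4)) * indicator {0..2*pi} \<theta>
          \<le> ennreal k * (ennreal (\<bar>\<theta> - b\<bar> powr (- 3 / 4)) * indicator {0..2*pi} \<theta>)"
          using True by (simp add: ennreal_leI ennreal_mult[symmetric] k_def)
        also have "\<dots> \<le> (\<Sum>b\<in>?B. ennreal k * (ennreal (\<bar>\<theta> - b\<bar> powr (- 3 / 4)) * indicator {0..2*pi} \<theta>))"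
          using b(1) by (intro member_le_sum[where f = "\<lambda>b. ennreal k * (ennreal (\<bar>\<theta> - b\<bar> powr (- 3 / 4)) * indicator {0..2*pi} \<theta>)"]) auto
        finally show ?thesis .
      qed simp
    qed
    also have "\<dots> = C"
      unfolding C_def by (subst nn_integral_sum) (auto simp: nn_integral_cmult)
    finally show "(\<integral>\<^sup>+\<theta>\<in>{0..2*pi}. ennreal (cmod (\<alpha> - of_real r * cis \<theta>) powr (- 3 / 4)) \<partial>lborel) \<le> C" .
  qed
qed

section \<open>Area integrals over the disc in Cartesian coordinates\<close>

lemma measurable_Complex [measurable]:
  "f \<in> borel_measurable M \<Longrightarrow> g \<in> borel_measurable M \<Longrightarrow> (\<lambda>x. Complex (f x) (g x)) \<in> borel_measurable M"
  by (simp add: borel_measurable_complex_iff)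

text \<open>Lebesgue measure is determined by its values on boxes. This opens the way to iterated
  integrals, the complex numbers not being a product type.\<close>

lemma lborel_complex: "lborel = distr (lborel \<Otimes>\<^sub>M lborel) borel (\<lambda>(x, y). Complex x y)"
proof (rule lborel_eqI)
  fix l u :: complex
  assume "\<And>b. b \<in> Basis \<Longrightarrow> l \<bullet> b \<le> u \<bullet> b"
  from this[of 1] this[of \<i>] have le: "Re l \<le> Re u" "Im l \<le> Im u"
    by (auto simp: Basis_complex_def)
  have "(\<lambda>(x, y). Complex x y) -` box l u \<inter> space (lborel \<Otimes>\<^sub>M lborel) = {Re l<..<Re u} \<times> {Im l<..<Im u}"
    by (auto simp: box_def Basis_complex_def space_pair_measure)
  then have "emeasure (distr (lborel \<Otimes>\<^sub>M lborel) borel (\<lambda>(x, y). Complex x y)) (box l u)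
      = emeasure (lborel \<Otimes>\<^sub>M lborel) ({Re l<..<Re u} \<times> {Im l<..<Im u})"
    by (subst emeasure_distr) auto
  also have "\<dots> = (\<Prod>b\<in>Basis. (u - l) \<bullet> b)"
    using le by (simp add: lborel.emeasure_pair_measure_Times Basis_complex_def ennreal_mult)
  finally show "emeasure (distr (lborel \<Otimes>\<^sub>M lborel) borel (\<lambda>(x, y). Complex x y)) (box l u) = (\<Prod>b\<in>Basis. (u - l) \<bullet> b)" .
qed simp

text \<open>The outer variable is the imaginary part in the first formula and the real part in the
  second; both are stated because the coordinate to single out depends on \<alpha>.\<close>

lemma nn_integral_complex:
  assumes [measurable]: "h \<in> borel_measurable borel"
  shows "(\<integral>\<^sup>+z. h z \<partial>lborel) = (\<integral>\<^sup>+v. \<integral>\<^sup>+u. h (Complex u v) \<partial>lborel \<partial>lborel)"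
    and "(\<integral>\<^sup>+z. h z \<partial>lborel) = (\<integral>\<^sup>+v. \<integral>\<^sup>+u. h (Complex v u) \<partial>lborel \<partial>lborel)"
proof -
  have eq: "(\<integral>\<^sup>+z. h z \<partial>lborel) = (\<integral>\<^sup>+p. h (case p of (x, y) \<Rightarrow> Complex x y) \<partial>(lborel \<Otimes>\<^sub>M lborel))"
    by (subst lborel_complex, subst nn_integral_distr) auto
  show "(\<integral>\<^sup>+z. h z \<partial>lborel) = (\<integral>\<^sup>+v. \<integral>\<^sup>+u. h (Complex u v) \<partial>lborel \<partial>lborel)"
    unfolding eq by (subst lborel_pair.nn_integral_snd[symmetric]) auto
  show "(\<integral>\<^sup>+z. h z \<partial>lborel) = (\<integral>\<^sup>+v. \<integral>\<^sup>+u. h (Complex v u) \<partial>lborel \<partial>lborel)"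
    unfolding eq by (subst lborel.nn_integral_fst[symmetric]) auto
qed

text \<open>The power \<open>- (3 / 4 * (\<beta> + 1))\<close> of the distance is traded for a power
  of the weight through \<open>1 - (cmod z)\<^sup>2 \<le> 2 * cmod (\<alpha> - z)\<close>, leaving
  the weight exponent \<open>(\<beta> + 1) / 4 - 1\<close>, still above -1. The remaining power -3/4
  is left to the coordinate distance. The minimum with 0 makes the exponent nonpositive for the
  chord integrals, harmless as the weight is at most 1.\<close>

lemma disc_integrand_le:
  fixes z \<alpha> :: complex and b v \<beta> :: real
  assumes \<alpha>: "cmod \<alpha> = 1" and z: "cmod z < 1" and \<beta>: "\<beta> > -1" and b: "v \<noteq> b" "\<bar>v - b\<bar> \<le> cmod (\<alpha> - z)"
  shows "cmod (\<alpha> - z) powr (- (3 / 4 * (\<beta> + 2))) * (1 - (cmod z)\<^sup>2) powr \<beta>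
    \<le> (1 / 2) powr (- (3 / 4 * (\<beta> + 1))) * ((1 - (cmod z)\<^sup>2) powr min ((\<beta> + 1) / 4 - 1) 0 * \<bar>v - b\<bar> powr (- 3 / 4))"
proof -
  let ?w = "1 - (cmod z)\<^sup>2" and ?n = "cmod (\<alpha> - z)"
  have w: "0 < ?w" "?w \<le> 1" using z by (auto simp: abs_square_less_1)
  have n: "0 < ?n" using b by linarith
  have "?w = (1 - cmod z) * (1 + cmod z)" by (simp add: power2_eq_square algebra_simps)
  also have "\<dots> \<le> (1 - cmod z) * 2" using z by (intro mult_left_mono) auto
  also have "\<dots> \<le> ?n * 2" using norm_triangle_ineq2[of \<alpha> z] \<alpha> by simp
  finally have wn: "1 / 2 * ?w \<le> ?n" by simp
  have "?n powr (- (3 / 4 * (\<beta> + 2))) * ?w powr \<beta> = ?n powr (- (3 / 4 * (\<beta> + 1))) * ?n powr (- 3 / 4) * ?w powr \<beta>"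
  proof -
    have "- (3 / 4 * (\<beta> + 2)) = - (3 / 4 * (\<beta> + 1)) + (- 3 / 4)" by (simp add: field_simps)
    then show ?thesis by (simp only: powr_add)
  qed
  also have "\<dots> \<le> (1 / 2 * ?w) powr (- (3 / 4 * (\<beta> + 1))) * \<bar>v - b\<bar> powr (- 3 / 4) * ?w powr \<beta>"
    using \<beta> w b wn by (intro mult_right_mono mult_mono powr_mono2') auto
  also have "\<dots> = (1 / 2) powr (- (3 / 4 * (\<beta> + 1))) * (?w powr ((\<beta> + 1) / 4 - 1) * \<bar>v - b\<bar> powr (- 3 / 4))"
  proof -
    have "?w powr ((\<beta> + 1) / 4 - 1) = ?w powr (- (3 / 4 * (\<beta> + 1))) * ?w powr \<beta>"
    proof -
      have "(\<beta> + 1) / 4 - 1 = - (3 / 4 * (\<beta> + 1)) + \<beta>" by (simp add: field_simps)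
      then show ?thesis by (simp only: powr_add)
    qed
    then show ?thesis using w by (subst powr_mult) (auto simp: mult_ac)
  qed
  also have "\<dots> \<le> (1 / 2) powr (- (3 / 4 * (\<beta> + 1))) * (?w powr min ((\<beta> + 1) / 4 - 1) 0 * \<bar>v - b\<bar> powr (- 3 / 4))"
    using w by (intro mult_left_mono mult_right_mono powr_mono') auto
  finally show ?thesis .
qed

text \<open>Near \<open>\<alpha>\<close> the singularity is split between the radial weight and one Cartesian coordinate \<open>v\<close>.
  The latter works only if the line \<open>v = b\<close> through \<open>\<alpha>\<close> is not close to being tangent to the circle,
  whence the bound on \<open>b\<close>; at least one of \<open>Re \<alpha>\<close> and \<open>Im \<alpha>\<close> meets it.\<close>

lemma iterated_disc_integral_finite:
  fixes c :: "real \<Rightarrow> real \<Rightarrow> complex"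
  assumes \<alpha>: "cmod \<alpha> = 1" and \<beta>: "\<beta> > -1" and b: "\<bar>b\<bar> \<le> 3 / 4"
    and c: "\<And>u v. (cmod (c u v))\<^sup>2 = u\<^sup>2 + v\<^sup>2" "\<And>u v. \<bar>v - b\<bar> \<le> cmod (\<alpha> - c u v)"
  shows "(\<integral>\<^sup>+v. \<integral>\<^sup>+u. ennreal (cmod (\<alpha> - c u v) powr (- (3 / 4 * (\<beta> + 2))) * (1 - (cmod (c u v))\<^sup>2) powr \<beta>)
      * indicator (ball 0 1) (c u v) \<partial>lborel \<partial>lborel) < \<infinity>"
proof -
  define k where "k = (1 / 2 :: real) powr (- (3 / 4 * (\<beta> + 1)))"
  define \<gamma> where "\<gamma> = min ((\<beta> + 1) / 4 - 1) 0"
  let ?h = "\<lambda>v u. ennreal ((1 - u\<^sup>2 - v\<^sup>2) powr \<gamma> * \<bar>v - b\<bar> powr (- 3 / 4)) * indicator {u. u\<^sup>2 + v\<^sup>2 < 1} u"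
  have \<gamma>: "-1 < \<gamma>" "\<gamma> \<le> 0" using \<beta> by (auto simp: \<gamma>_def)
  have m [measurable]: "(\<lambda>u. ?h v u) \<in> borel_measurable borel" for v
  proof -
    have [measurable]: "{u. u\<^sup>2 + v\<^sup>2 < 1} \<in> sets borel" by measurable
    show ?thesis by measurable
  qed
  have ball: "c u v \<in> ball 0 1 \<longleftrightarrow> u\<^sup>2 + v\<^sup>2 < 1" for u v
    using abs_square_less_1[of "cmod (c u v)"] by (simp add: c(1))
  have "(\<integral>\<^sup>+v. \<integral>\<^sup>+u. ennreal (cmod (\<alpha> - c u v) powr (- (3 / 4 * (\<beta> + 2))) * (1 - (cmod (c u v))\<^sup>2) powr \<beta>)
      * indicator (ball 0 1) (c u v) \<partial>lborel \<partial>lborel)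
    \<le> (\<integral>\<^sup>+v. \<integral>\<^sup>+u. ennreal k * ?h v u \<partial>lborel \<partial>lborel)"
  \<comment> \<open>The line \<open>v = b\<close> is discarded because \<open>0 powr a = 0\<close>
    makes the majorant vanish on it.\<close>
  proof (rule nn_integral_mono_AE, rule AE_mp[OF AE_lborel_singleton[of b]], rule AE_I2, rule impI, rule nn_integral_mono)
    fix u v :: real assume v: "v \<noteq> b"
    show "ennreal (cmod (\<alpha> - c u v) powr (- (3 / 4 * (\<beta> + 2))) * (1 - (cmod (c u v))\<^sup>2) powr \<beta>) * indicator (ball 0 1) (c u v)
        \<le> ennreal k * ?h v u"
    proof (cases "c u v \<in> ball 0 1")
      case True
      then have "cmod (\<alpha> - c u v) powr (- (3 / 4 * (\<beta> + 2))) * (1 - (cmod (c u v))\<^sup>2) powr \<beta>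
          \<le> k * ((1 - (cmod (c u v))\<^sup>2) powr \<gamma> * \<bar>v - b\<bar> powr (- 3 / 4))"
        unfolding k_def \<gamma>_def using \<alpha> \<beta> v c(2) by (intro disc_integrand_le) auto
      moreover have e: "1 - (cmod (c u v))\<^sup>2 = 1 - u\<^sup>2 - v\<^sup>2" by (simp add: c(1))
      moreover have "k \<ge> 0" by (simp add: k_def)
      moreover have "indicator {u. u\<^sup>2 + v\<^sup>2 < 1} u = (1 :: ennreal)" using True ball by simp
      ultimately show ?thesis
        unfolding e using True by (simp add: ennreal_leI ennreal_mult[symmetric])
    qed simp
  qed
  also have "\<dots> = (\<integral>\<^sup>+v. ennreal k * (\<integral>\<^sup>+u. ?h v u \<partial>lborel) \<partial>lborel)"
    by (intro nn_integral_cong nn_integral_cmult) measurable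
  also have "\<dots> = ennreal k * (\<integral>\<^sup>+v. \<integral>\<^sup>+u. ?h v u \<partial>lborel \<partial>lborel)"
  proof (intro nn_integral_cmult)
    have [measurable]: "{p :: real \<times> real. (snd p)\<^sup>2 + (fst p)\<^sup>2 < 1} \<in> sets (borel \<Otimes>\<^sub>M borel)"
      unfolding borel_prod by (intro borel_open open_Collect_less continuous_intros)
    have "(\<lambda>p. ennreal ((1 - (snd p)\<^sup>2 - (fst p)\<^sup>2) powr \<gamma> * \<bar>fst p - b\<bar> powr (- 3 / 4)) * indicator {p. (snd p)\<^sup>2 + (fst p)\<^sup>2 < 1} p)
        \<in> borel_measurable (borel \<Otimes>\<^sub>M lborel)"
      by measurable
    from lborel.borel_measurable_nn_integral_fst[OF this]
    show "(\<lambda>v. \<integral>\<^sup>+u. ?h v u \<partial>lborel) \<in> borel_measurable lborel"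
      by (simp add: indicator_def)
  qed
  also have "\<dots> < \<infinity>"
    using nn_integral_disc_weight_finite[OF b \<gamma>] by (simp add: ennreal_mult_less_top)
  finally show ?thesis .
qed

lemma disc_integral_finite:
  assumes \<alpha>: "cmod \<alpha> = 1" and \<beta>: "\<beta> > -1"
  shows "(\<integral>\<^sup>+z\<in>ball 0 1. ennreal (cmod (\<alpha> - z) powr (- (3 / 4 * (\<beta> + 2))) * (1 - (cmod z)\<^sup>2) powr \<beta>) \<partial>lborel) < \<infinity>"
    (is "(\<integral>\<^sup>+z. ?F z \<partial>lborel) < \<infinity>")
proof -
  have [measurable]: "ball (0 :: complex) 1 \<in> sets borel" by simp
  have [measurable]: "?F \<in> borel_measurable borel" by measurable
  have 1: "(Re \<alpha>)\<^sup>2 + (Im \<alpha>)\<^sup>2 = 1" using \<alpha> by (simp add: cmod_power2[symmetric])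
  \<comment> \<open>Two squares above 9/16 would add up to more than 1. The coordinate found here
    becomes the outer variable.\<close>
  have "\<bar>Im \<alpha>\<bar> \<le> 3 / 4 \<or> \<bar>Re \<alpha>\<bar> \<le> 3 / 4"
  proof (rule ccontr)
    assume "\<not> ?thesis"
    then have "(3 / 4)\<^sup>2 < \<bar>Im \<alpha>\<bar>\<^sup>2" "(3 / 4)\<^sup>2 < \<bar>Re \<alpha>\<bar>\<^sup>2" by (intro power_strict_mono; simp)+
    then show False using 1 by (simp add: power2_eq_square)
  qed
  then show ?thesis
  proof
    assume b: "\<bar>Im \<alpha>\<bar> \<le> 3 / 4"
    have "\<bar>v - Im \<alpha>\<bar> \<le> cmod (\<alpha> - Complex u v)" for u v
      using abs_Im_le_cmod[of "\<alpha> - Complex u v"] by (simp add: abs_minus_commute)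
    then show ?thesis
      by (subst nn_integral_complex(1), measurable)
         (rule iterated_disc_integral_finite[OF \<alpha> \<beta> b], auto simp: cmod_power2)
  next
    assume b: "\<bar>Re \<alpha>\<bar> \<le> 3 / 4"
    have "\<bar>v - Re \<alpha>\<bar> \<le> cmod (\<alpha> - Complex v u)" for u v
      using abs_Re_le_cmod[of "\<alpha> - Complex v u"] by (simp add: abs_minus_commute)
    then show ?thesis
      by (subst nn_integral_complex(2), measurable)
         (rule iterated_disc_integral_finite[OF \<alpha> \<beta> b], auto simp: cmod_power2)
  qed
qed

section \<open>The test function\<close>

lemma (in pair_sigma_finite) nn_integral_times:
  assumes [measurable]: "f \<in> borel_measurable M1" "g \<in> borel_measurable M2"
  shows "(\<integral>\<^sup>+p. f (fst p) * g (snd p) \<partial>(M1 \<Otimes>\<^sub>M M2)) = (\<integral>\<^sup>+x. f x \<partial>M1) * (\<integral>\<^sup>+y. g y \<partial>M2)"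
  by (subst M2.nn_integral_fst[symmetric]) (simp_all add: nn_integral_cmult nn_integral_multc)

text \<open>Powers are taken factor by factor, so that the norm integrals split into one-variable
  ones; the exponent is halved because the norm squares the modulus. For unimodular \<alpha>, the
  base \<open>1 - cnj \<alpha> * z\<close> has the modulus of \<open>\<alpha> - z\<close> but lies
  in the right half-plane, off the branch cut of the principal power.\<close>

definition test_fun :: "complex \<Rightarrow> complex \<Rightarrow> real \<Rightarrow> complex \<times> complex \<Rightarrow> complex" where
  "test_fun \<alpha>1 \<alpha>2 s z =
     (1 - cnj \<alpha>1 * fst z) powr of_real (- s / 2) * (1 - cnj \<alpha>2 * snd z) powr of_real (- s / 2)"

lemma cmod_one_minus_cnj_mult:
  assumes "cmod \<alpha> = 1"
  shows "cmod (1 - cnj \<alpha> * z) = cmod (\<alpha> - z)"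
proof -
  have "\<alpha> * (1 - cnj \<alpha> * z) = \<alpha> - z"
  proof -
    have "\<alpha> * cnj \<alpha> = 1" using complex_norm_square[of \<alpha>] assms by simp
    moreover have "\<alpha> * (1 - cnj \<alpha> * z) = \<alpha> - \<alpha> * cnj \<alpha> * z" by (simp add: algebra_simps)
    ultimately show ?thesis by simp
  qed
  then have "cmod \<alpha> * cmod (1 - cnj \<alpha> * z) = cmod (\<alpha> - z)" by (metis norm_mult)
  then show ?thesis using assms by simp
qed

lemma cmod_test_fun_sq:
  assumes "cmod \<alpha>1 = 1" "cmod \<alpha>2 = 1"
  shows "(cmod (test_fun \<alpha>1 \<alpha>2 s z))\<^sup>2 = cmod (\<alpha>1 - fst z) powr (- s) * cmod (\<alpha>2 - snd z) powr (- s)"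
proof -
  have "(cmod (w powr of_real (- s / 2)))\<^sup>2 = cmod w powr (- s)" for w
  proof -
    have "cmod (w powr of_real (- s / 2)) = cmod w powr (- s / 2)"
      using norm_powr_real_powr'[OF Reals_of_real, of w "- s / 2"] by (simp only: Re_complex_of_real)
    then have "(cmod (w powr of_real (- s / 2)))\<^sup>2 = cmod w powr (- s / 2 + - s / 2)"
      by (simp only: power2_eq_square powr_add)
    then show ?thesis by simp
  qed
  then show ?thesis
    by (simp only: test_fun_def norm_mult power_mult_distrib cmod_one_minus_cnj_mult[OF assms(1)]
        cmod_one_minus_cnj_mult[OF assms(2)])
qed

lemma holomorphic_test_fun:
  assumes \<alpha>: "cmod \<alpha>1 = 1" "cmod \<alpha>2 = 1"
  shows "holomorphic_bidisc (test_fun \<alpha>1 \<alpha>2 s)"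
  unfolding holomorphic_bidisc_def
proof
  fix z assume z: "z \<in> bidisc"
  have ex: "\<exists>D. ((\<lambda>w. (1 - cnj \<alpha> * w) powr of_real (- s / 2)) has_field_derivative D) (at w)"
    if "cmod \<alpha> = 1" "cmod w < 1" for \<alpha> w
  proof -
    have "Re (cnj \<alpha> * w) \<le> cmod (cnj \<alpha> * w)" by (rule complex_Re_le_cmod)
    also have "\<dots> < 1" using that by (simp add: norm_mult)
    finally have "1 - cnj \<alpha> * w \<notin> \<real>\<^sub>\<le>\<^sub>0"
      by (simp add: complex_nonpos_Reals_iff)
    then have powr: "((\<lambda>v. v powr of_real (- s / 2)) has_field_derivative
        of_real (- s / 2) * (1 - cnj \<alpha> * w) powr (of_real (- s / 2) - 1)) (at (1 - cnj \<alpha> * w))"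
      by (rule has_field_derivative_powr)
    have "((\<lambda>w. 1 - cnj \<alpha> * w) has_field_derivative - cnj \<alpha>) (at w)"
      by (auto intro!: derivative_eq_intros)
    from DERIV_chain2[OF powr this] show ?thesis by (rule exI)
  qed
  obtain D1 where D1: "((\<lambda>w. (1 - cnj \<alpha>1 * w) powr of_real (- s / 2)) has_field_derivative D1) (at (fst z))"
    using ex[OF \<alpha>(1), of "fst z"] z by (auto simp: bidisc_iff)
  obtain D2 where D2: "((\<lambda>w. (1 - cnj \<alpha>2 * w) powr of_real (- s / 2)) has_field_derivative D2) (at (snd z))"
    using ex[OF \<alpha>(2), of "snd z"] z by (auto simp: bidisc_iff)
  have 1: "((\<lambda>z. (1 - cnj \<alpha>1 * fst z) powr of_real (- s / 2)) has_derivative (\<lambda>h. D1 * fst h)) (at z)"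
    by (rule has_derivative_compose[OF bounded_linear_imp_has_derivative[OF bounded_linear_fst] D1[unfolded has_field_derivative_def]])
  have 2: "((\<lambda>z. (1 - cnj \<alpha>2 * snd z) powr of_real (- s / 2)) has_derivative (\<lambda>h. D2 * snd h)) (at z)"
    by (rule has_derivative_compose[OF bounded_linear_imp_has_derivative[OF bounded_linear_snd] D2[unfolded has_field_derivative_def]])
  let ?a = "D1 * (1 - cnj \<alpha>2 * snd z) powr of_real (- s / 2)"
  let ?b = "(1 - cnj \<alpha>1 * fst z) powr of_real (- s / 2) * D2"
  have "(test_fun \<alpha>1 \<alpha>2 s has_derivative (\<lambda>h. ?a * fst h + ?b * snd h)) (at z)"
    unfolding test_fun_def[abs_def]
    by (rule has_derivative_eq_rhs[OF has_derivative_mult[OF 1 2]]) (auto simp: algebra_simps)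
  then show "\<exists>a b. (test_fun \<alpha>1 \<alpha>2 s has_derivative (\<lambda>h. a * fst h + b * snd h)) (at z)" by blast
qed

lemma bergman_sq_test_fun_finite:
  assumes \<alpha>: "cmod \<alpha>1 = 1" "cmod \<alpha>2 = 1" and \<beta>: "\<beta> > -1"
  shows "bergman_sq \<beta> (test_fun \<alpha>1 \<alpha>2 (3 / 4 * (\<beta> + 2))) < \<infinity>"
proof -
  define F where "F \<alpha> z = ennreal (cmod (\<alpha> - z) powr (- (3 / 4 * (\<beta> + 2))) * (1 - (cmod z)\<^sup>2) powr \<beta>) * indicator (ball 0 1) z"
    for \<alpha> z :: complex
  have [measurable]: "ball (0 :: complex) 1 \<in> sets borel" by simp
  have m [measurable]: "F \<alpha> \<in> borel_measurable borel" for \<alpha> unfolding F_def by measurable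
  have fin: "(\<integral>\<^sup>+z. F \<alpha> z \<partial>dA) < \<infinity>" if "cmod \<alpha> = 1" for \<alpha>
    using disc_integral_finite[OF that \<beta>] unfolding dA_def
    by (simp add: nn_integral_density nn_integral_cmult ennreal_mult_less_top F_def)
  have "bergman_sq \<beta> (test_fun \<alpha>1 \<alpha>2 (3 / 4 * (\<beta> + 2))) = (\<integral>\<^sup>+z. F \<alpha>1 (fst z) * F \<alpha>2 (snd z) \<partial>dV)"
    unfolding bergman_sq_def
  proof (rule nn_integral_cong)
    fix z :: "complex \<times> complex"
    show "ennreal ((cmod (test_fun \<alpha>1 \<alpha>2 (3 / 4 * (\<beta> + 2)) z))\<^sup>2 * (1 - (cmod (fst z))\<^sup>2) powr \<beta> * (1 - (cmod (snd z))\<^sup>2) powr \<beta>)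
        * indicator bidisc z = F \<alpha>1 (fst z) * F \<alpha>2 (snd z)"
      unfolding cmod_test_fun_sq[OF \<alpha>] F_def
      by (simp add: ennreal_mult[symmetric] bidisc_def mem_Times_iff mult_ac indicator_def)
  qed
  also have "\<dots> = (\<integral>\<^sup>+z. F \<alpha>1 z \<partial>dA) * (\<integral>\<^sup>+z. F \<alpha>2 z \<partial>dA)"
    unfolding dV_def by (rule dA_pair.nn_integral_times) (simp_all add: dA_def)
  also have "\<dots> < \<infinity>" using fin \<alpha> by (simp add: ennreal_mult_less_top)
  finally show ?thesis .
qed

lemma hardy_sq_test_fun_finite:
  assumes \<alpha>: "cmod \<alpha>1 = 1" "cmod \<alpha>2 = 1"
  shows "hardy_sq (test_fun \<alpha>1 \<alpha>2 (3 / 4)) < \<infinity>"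
proof -
  obtain C1 where C1: "C1 < \<infinity>"
    "\<And>r. 0 < r \<Longrightarrow> r < 1 \<Longrightarrow> (\<integral>\<^sup>+\<theta>\<in>{0..2*pi}. ennreal (cmod (\<alpha>1 - of_real r * cis \<theta>) powr (- 3 / 4)) \<partial>lborel) \<le> C1"
    using circle_integral_bounded[OF \<alpha>(1)] by blast
  obtain C2 where C2: "C2 < \<infinity>"
    "\<And>r. 0 < r \<Longrightarrow> r < 1 \<Longrightarrow> (\<integral>\<^sup>+\<theta>\<in>{0..2*pi}. ennreal (cmod (\<alpha>2 - of_real r * cis \<theta>) powr (- 3 / 4)) \<partial>lborel) \<le> C2"
    using circle_integral_bounded[OF \<alpha>(2)] by blast
  have "hardy_sq (test_fun \<alpha>1 \<alpha>2 (3 / 4)) \<le> ennreal (1 / (2 * pi)\<^sup>2) * (C1 * C2)"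
    unfolding hardy_sq_def
  proof (intro SUP_least mult_left_mono)
    fix r :: real assume "r \<in> {0<..<1}"
    then have r: "0 < r" "r < 1" by auto
    define G where "G \<alpha> \<theta> = ennreal (cmod (\<alpha> - of_real r * cis \<theta>) powr (- 3 / 4)) * indicator {0..2*pi} \<theta>" for \<alpha> \<theta>
    have "cis \<in> borel_measurable borel"
      by (intro borel_measurable_continuous_onI continuous_intros)
    note [measurable] = measurable_compose[OF _ this]
    have m [measurable]: "G \<alpha> \<in> borel_measurable borel" for \<alpha> unfolding G_def by measurable
    have "(\<integral>\<^sup>+\<theta>\<in>{0..2*pi} \<times> {0..2*pi}.
        ennreal ((cmod (test_fun \<alpha>1 \<alpha>2 (3 / 4) (of_real r * cis (fst \<theta>), of_real r * cis (snd \<theta>))))\<^sup>2) \<partial>lborel)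
      = (\<integral>\<^sup>+\<theta>. G \<alpha>1 (fst \<theta>) * G \<alpha>2 (snd \<theta>) \<partial>(lborel \<Otimes>\<^sub>M lborel))"
      unfolding lborel_prod
      by (rule nn_integral_cong) (simp add: cmod_test_fun_sq[OF \<alpha>] G_def ennreal_mult indicator_times mult_ac)
    also have "\<dots> = (\<integral>\<^sup>+\<theta>. G \<alpha>1 \<theta> \<partial>lborel) * (\<integral>\<^sup>+\<theta>. G \<alpha>2 \<theta> \<partial>lborel)"
      by (rule lborel_pair.nn_integral_times) simp_all
    also have "\<dots> \<le> C1 * C2"
      unfolding G_def by (intro mult_mono C1(2) C2(2) r) auto
    finally show "(\<integral>\<^sup>+\<theta>\<in>{0..2*pi} \<times> {0..2*pi}.
        ennreal ((cmod (test_fun \<alpha>1 \<alpha>2 (3 / 4) (of_real r * cis (fst \<theta>), of_real r * cis (snd \<theta>))))\<^sup>2) \<partial>lborel) \<le> C1 * C2" .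
  qed simp
  also have "\<dots> < \<infinity>" using C1(1) C2(1) by (simp add: ennreal_mult_less_top)
  finally show ?thesis .
qed

lemma test_fun_in_A2:
  assumes \<alpha>: "cmod \<alpha>1 = 1" "cmod \<alpha>2 = 1" and \<beta>: "\<beta> \<ge> -1"
  shows "test_fun \<alpha>1 \<alpha>2 (3 / 4 * (\<beta> + 2)) \<in> A2 \<beta>"
proof -
  have "A2_sq \<beta> (test_fun \<alpha>1 \<alpha>2 (3 / 4 * (\<beta> + 2))) < \<infinity>"
  proof (cases "\<beta> = -1")
    case True
    then have "3 / 4 * (\<beta> + 2) = 3 / 4" by simp
    then show ?thesis
      using hardy_sq_test_fun_finite[OF \<alpha>] True by (simp only: A2_sq_def) simp
  next
    case False
    then show ?thesis
      using bergman_sq_test_fun_finite[OF \<alpha>, of \<beta>] \<beta> by (simp only: A2_sq_def if_False)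
  qed
  then show ?thesis
    using holomorphic_test_fun[OF \<alpha>] by (simp only: A2_def mem_Collect_eq)
qed

section \<open>Divergence after composition\<close>

lemma ennreal_unbounded_powr:
  fixes c d0 s :: real
  assumes c: "0 < c" and d0: "0 < d0" and s: "0 < s"
    and le: "\<And>d. 0 < d \<Longrightarrow> d \<le> d0 \<Longrightarrow> ennreal (c * d powr (- s)) \<le> X"
  shows "X = \<infinity>"
proof (rule ccontr)
  assume "X \<noteq> \<infinity>"
  then obtain M where M: "X = ennreal M" "0 \<le> M" by (cases X) auto
  \<comment> \<open>Chosen so that \<open>c * Y = M + c\<close> exceeds the supposed bound
    \<open>M\<close>; \<open>Y powr (- 1 / s)\<close> is the scale at which the power reaches
    \<open>Y\<close>.\<close>
  define Y where "Y = M / c + 1"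
  have Y: "0 < Y" using M(2) c by (simp add: Y_def add_nonneg_pos)
  define d where "d = min d0 (Y powr (- 1 / s))"
  have d: "0 < d" "d \<le> d0" using d0 Y by (auto simp: d_def)
  have "Y = (Y powr (- 1 / s)) powr (- s)" using Y s by (simp add: powr_powr)
  also have "\<dots> \<le> d powr (- s)" using d s by (intro powr_mono2') (auto simp: d_def)
  finally have "c * Y \<le> c * d powr (- s)" using c by simp
  moreover have "c * d powr (- s) \<le> M" using le[OF d] M by (simp add: ennreal_le_iff)
  moreover have "c * Y = M + c" using c by (simp add: Y_def field_simps)
  ultimately show False using c by simp
qed

lemma cmod_test_fun_comp_ge:
  assumes \<alpha>: "cmod \<alpha>1 = 1" "cmod \<alpha>2 = 1" and s: "s \<ge> 0"
    and w: "w \<in> bidisc" "cmod (fst w - \<alpha>1) \<le> R" "cmod (snd w - \<alpha>2) \<le> R"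
  shows "R powr (- (2 * s)) \<le> (cmod (test_fun \<alpha>1 \<alpha>2 s w))\<^sup>2"
proof -
  have ne: "0 < cmod (\<alpha>1 - fst w)" "0 < cmod (\<alpha>2 - snd w)" using \<alpha> w(1) by (auto simp: bidisc_iff)
  have "R powr (- (2 * s)) = R powr (- s) * R powr (- s)" by (simp add: powr_add[symmetric])
  also have "\<dots> \<le> cmod (\<alpha>1 - fst w) powr (- s) * cmod (\<alpha>2 - snd w) powr (- s)"
    using ne w(2,3) s by (intro mult_mono powr_mono2') (auto simp: norm_minus_commute)
  finally show ?thesis by (simp add: cmod_test_fun_sq[OF \<alpha>])
qed

text \<open>The disjunction lets both directions of the line share one argument: the box is thin, of
  size \<open>d\<close>, in the coordinate that controls \<Phi>, and keeps the fixed size \<eta> in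
  the other.\<close>

lemma A2_sq_test_fun_comp_infinite:
  assumes \<alpha>: "cmod \<alpha>1 = 1" "cmod \<alpha>2 = 1" and \<beta>: "\<beta> \<ge> -1"
    and \<Phi>: "\<And>z. z \<in> bidisc \<Longrightarrow> \<Phi> z \<in> bidisc"
    and \<zeta>: "cmod \<zeta>1 = 1" "cmod \<zeta>2 = 1" and C: "C > 0" and \<epsilon>: "\<epsilon> > 0"
    and near: "(\<forall>z\<in>bidisc. cmod (fst z - \<zeta>1) \<le> \<epsilon> \<and> cmod (snd z - \<zeta>2) \<le> \<epsilon> \<longrightarrow>
        cmod (fst (\<Phi> z) - \<alpha>1) \<le> C * cmod (fst z - \<zeta>1) \<and> cmod (snd (\<Phi> z) - \<alpha>2) \<le> C * cmod (fst z - \<zeta>1)) \<or>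
      (\<forall>z\<in>bidisc. cmod (fst z - \<zeta>1) \<le> \<epsilon> \<and> cmod (snd z - \<zeta>2) \<le> \<epsilon> \<longrightarrow>
        cmod (fst (\<Phi> z) - \<alpha>1) \<le> C * cmod (snd z - \<zeta>2) \<and> cmod (snd (\<Phi> z) - \<alpha>2) \<le> C * cmod (snd z - \<zeta>2))"
  shows "A2_sq \<beta> (test_fun \<alpha>1 \<alpha>2 (3 / 4 * (\<beta> + 2)) \<circ> \<Phi>) = \<infinity>"
proof -
  let ?s = "3 / 4 * (\<beta> + 2)"
  let ?g = "test_fun \<alpha>1 \<alpha>2 ?s \<circ> \<Phi>"
  obtain c where c: "c > 0" and lower:
    "\<And>\<zeta>1 \<zeta>2 d1 d2 K g. \<lbrakk>cmod \<zeta>1 = 1; cmod \<zeta>2 = 1; 0 < d1; d1 \<le> 1 / 4; 0 < d2; d2 \<le> 1 / 4; K \<ge> 0;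
        \<And>z. z \<in> bidisc \<Longrightarrow> cmod (fst z - \<zeta>1) \<le> 3 * d1 \<Longrightarrow> cmod (snd z - \<zeta>2) \<le> 3 * d2 \<Longrightarrow> K \<le> (cmod (g z))\<^sup>2\<rbrakk> \<Longrightarrow>
      ennreal (c * K * d1 powr (\<beta> + 2) * d2 powr (\<beta> + 2)) \<le> A2_sq \<beta> g"
    using A2_sq_ge[of \<beta>] by blast
  \<comment> \<open>The lower bound for the norm works with sizes up to 1/4 and tests points up to
    three times the size away, which must stay within \<epsilon>.\<close>
  define \<eta> where "\<eta> = min (1 / 4) (\<epsilon> / 3)"
  have \<eta>: "0 < \<eta>" "\<eta> \<le> 1 / 4" "3 * \<eta> \<le> \<epsilon>" using \<epsilon> by (auto simp: \<eta>_def)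
  define c' where "c' = c * (3 * C) powr (- (2 * ?s)) * \<eta> powr (\<beta> + 2)"
  have c': "c' > 0" using c C \<eta> by (simp add: c'_def)
  have "ennreal (c' * d powr (- ((\<beta> + 2) / 2))) \<le> A2_sq \<beta> ?g" if d: "0 < d" "d \<le> \<eta>" for d
  proof -
    let ?K = "(C * (3 * d)) powr (- (2 * ?s))"
    have K: "?K = (3 * C) powr (- (2 * ?s)) * d powr (- (2 * ?s))"
      using C d by (subst powr_mult[symmetric]) (auto simp: mult_ac)
    \<comment> \<open>Growth \<open>3 / 2 * (\<beta> + 2)\<close> against mass
      \<open>\<beta> + 2\<close>: the surplus of half is what makes the lower bound blow up.\<close>
    have dd: "d powr (- (2 * ?s)) * d powr (\<beta> + 2) = d powr (- ((\<beta> + 2) / 2))"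
      unfolding powr_add[symmetric] by (rule arg_cong) (simp add: field_simps)
    have eq: "c * ?K * d powr (\<beta> + 2) * \<eta> powr (\<beta> + 2) = c' * d powr (- ((\<beta> + 2) / 2))"
      unfolding K c'_def dd[symmetric] by (simp only: mult_ac)
    have s: "?s \<ge> 0" using \<beta> by simp
    have ge: "?K \<le> (cmod (?g z))\<^sup>2" if z: "z \<in> bidisc"
      and "cmod (fst (\<Phi> z) - \<alpha>1) \<le> C * x" "cmod (snd (\<Phi> z) - \<alpha>2) \<le> C * x" "x \<le> 3 * d" for z x
    proof -
      have "C * x \<le> C * (3 * d)" using C that by simp
      then show ?thesis
        unfolding comp_def using that by (intro cmod_test_fun_comp_ge[OF \<alpha> s \<Phi>[OF z]]) auto
    qed
    have d': "d \<le> 1 / 4" "3 * d \<le> \<epsilon>" using d \<eta> by auto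
    from near show ?thesis
    proof
      assume *: "\<forall>z\<in>bidisc. cmod (fst z - \<zeta>1) \<le> \<epsilon> \<and> cmod (snd z - \<zeta>2) \<le> \<epsilon> \<longrightarrow>
        cmod (fst (\<Phi> z) - \<alpha>1) \<le> C * cmod (fst z - \<zeta>1) \<and> cmod (snd (\<Phi> z) - \<alpha>2) \<le> C * cmod (fst z - \<zeta>1)"
      have "ennreal (c * ?K * d powr (\<beta> + 2) * \<eta> powr (\<beta> + 2)) \<le> A2_sq \<beta> ?g"
      proof (rule lower[OF \<zeta> d(1) d'(1) \<eta>(1,2)])
        fix z assume z: "z \<in> bidisc" "cmod (fst z - \<zeta>1) \<le> 3 * d" "cmod (snd z - \<zeta>2) \<le> 3 * \<eta>"
        then show "?K \<le> (cmod (?g z))\<^sup>2"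
          using * d' \<eta>(3) by (intro ge[where x = "cmod (fst z - \<zeta>1)"]) auto
      qed simp
      then show ?thesis by (simp only: eq)
    next
      assume *: "\<forall>z\<in>bidisc. cmod (fst z - \<zeta>1) \<le> \<epsilon> \<and> cmod (snd z - \<zeta>2) \<le> \<epsilon> \<longrightarrow>
        cmod (fst (\<Phi> z) - \<alpha>1) \<le> C * cmod (snd z - \<zeta>2) \<and> cmod (snd (\<Phi> z) - \<alpha>2) \<le> C * cmod (snd z - \<zeta>2)"
      have "ennreal (c * ?K * \<eta> powr (\<beta> + 2) * d powr (\<beta> + 2)) \<le> A2_sq \<beta> ?g"
      proof (rule lower[OF \<zeta> \<eta>(1,2) d(1) d'(1)])
        fix z assume z: "z \<in> bidisc" "cmod (fst z - \<zeta>1) \<le> 3 * \<eta>" "cmod (snd z - \<zeta>2) \<le> 3 * d"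
        then show "?K \<le> (cmod (?g z))\<^sup>2"
          using * d' \<eta>(3) by (intro ge[where x = "cmod (snd z - \<zeta>2)"]) auto
      qed simp
      then show ?thesis unfolding eq[symmetric] by (simp only: mult_ac)
    qed
  qed
  then show ?thesis
    using c' \<eta>(1) \<beta> by (intro ennreal_unbounded_powr[where c = c' and s = "(\<beta> + 2) / 2" and ?d0.0 = \<eta>]) auto
qed

theorem theorem2p3:
  fixes \<phi>1 \<phi>2 :: "complex \<times> complex \<Rightarrow> complex"
    and \<alpha>1 \<alpha>2 \<tau> :: complex
  assumes "rational_inner \<phi>1" and "rational_inner \<phi>2"
    and "\<And>z. z \<in> bidisc \<Longrightarrow> (\<phi>1 z, \<phi>2 z) \<in> bidisc"
    and "cmod \<alpha>1 = 1" and "cmod \<alpha>2 = 1" and "cmod \<tau> = 1"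
    and "(vertical_line \<tau> \<subseteq> level_set \<phi>1 \<alpha>1 \<and> vertical_line \<tau> \<subseteq> level_set \<phi>2 \<alpha>2) \<or>
         (horizontal_line \<tau> \<subseteq> level_set \<phi>1 \<alpha>1 \<and> horizontal_line \<tau> \<subseteq> level_set \<phi>2 \<alpha>2)"
  shows "\<forall>\<beta>\<ge>-1. \<not> bounded_on_A2 \<beta> (composition_op (\<lambda>z. (\<phi>1 z, \<phi>2 z)))"
proof (intro allI impI notI)
  fix \<beta> :: real
  assume \<beta>: "-1 \<le> \<beta>" and bounded: "bounded_on_A2 \<beta> (composition_op (\<lambda>z. (\<phi>1 z, \<phi>2 z)))"
  let ?f = "test_fun \<alpha>1 \<alpha>2 (3 / 4 * (\<beta> + 2))"
  let ?\<Phi> = "\<lambda>z. (\<phi>1 z, \<phi>2 z)"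
  note quot = assms(1,2)[THEN rational_inner_imp_poly_quotient]
  have "A2_sq \<beta> (?f \<circ> ?\<Phi>) = \<infinity>"
    using assms(7)
  proof
    assume "vertical_line \<tau> \<subseteq> level_set \<phi>1 \<alpha>1 \<and> vertical_line \<tau> \<subseteq> level_set \<phi>2 \<alpha>2"
    then obtain w C \<epsilon> where "cmod w = 1" "C > 0" "\<epsilon> > 0"
      "\<forall>z\<in>bidisc. cmod (fst z - \<tau>) \<le> \<epsilon> \<and> cmod (snd z - w) \<le> \<epsilon> \<longrightarrow>
        cmod (\<phi>1 z - \<alpha>1) \<le> C * cmod (fst z - \<tau>) \<and> cmod (\<phi>2 z - \<alpha>2) \<le> C * cmod (fst z - \<tau>)"
      using near_vertical_line[OF quot assms(3,6)] by blast
    then show ?thesis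
      using assms(3) by (intro A2_sq_test_fun_comp_infinite[OF assms(4,5) \<beta> _ assms(6), where ?\<zeta>2.0 = w and C = C and \<epsilon> = \<epsilon>]) simp_all
  next
    assume "horizontal_line \<tau> \<subseteq> level_set \<phi>1 \<alpha>1 \<and> horizontal_line \<tau> \<subseteq> level_set \<phi>2 \<alpha>2"
    then obtain w C \<epsilon> where "cmod w = 1" "C > 0" "\<epsilon> > 0"
      "\<forall>z\<in>bidisc. cmod (fst z - w) \<le> \<epsilon> \<and> cmod (snd z - \<tau>) \<le> \<epsilon> \<longrightarrow>
        cmod (\<phi>1 z - \<alpha>1) \<le> C * cmod (snd z - \<tau>) \<and> cmod (\<phi>2 z - \<alpha>2) \<le> C * cmod (snd z - \<tau>)"
      using near_horizontal_line[OF quot assms(3,6)] by blast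
    then show ?thesis
      using assms(3) by (intro A2_sq_test_fun_comp_infinite[OF assms(4,5) \<beta> _ _ assms(6), where ?\<zeta>1.0 = w and C = C and \<epsilon> = \<epsilon>]) simp_all
  qed
  \<comment> \<open>Boundedness includes mapping the space into itself, and this is what the test
    function refutes.\<close>
  moreover have "?f \<circ> ?\<Phi> \<in> A2 \<beta>"
    using bounded test_fun_in_A2[OF assms(4,5) \<beta>] by (auto simp: bounded_on_A2_def composition_op_def)
  ultimately show False by (simp add: A2_def)
qed

end
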